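(* Let $F\subset\mathbb R^n$ be a closed set, $Y$ a normed linear space, $f\colon F\to Y$ an arbitrary function and $L\colon F\to\mathcal L(\mathbb R^n,Y)$ a function that is Baire one on $F$. Then there exists a function $\bar f\colon\mathbb R^n\to Y$ such that (i) $\bar f=f$ on $F$; (ii) if $a\in F$ and $f$ is continuous at $a$ (with respect to $F$), then $\bar f$ is continuous at $a$; (iii) if $a\in F$, $\alpha\in(0,1]$ and $f$ is $\alpha$-Hölder continuous at $a$ (with respect to $F$), then $\bar f$ is $\alpha$-Hölder continuous at $a$; in particular, if $f$ is Lipschitz at $a$ (with respect to $F$), then $\bar f$ is Lipschitz at $a$; (iv) if $a\in F$ and $L(a)$ is a relative Fréchet derivative of $f$ at $a$ (with respect to $F$), then $(\bar f)'(a)=L(a)$; (v) $\bar f|_{\mathbb R^n\setminus F}\in C^\infty(\mathbb R^n\setminus F,Y)$; (vi) if $a\in F$, $L$ is continuous at $a$ (with respect to $F$) and $L(a)$ is a relative strict derivative of $f$ at $a$ (with respect to $F$), then the Fréchet derivative $(\bar f)'$ is continuous at $a$ with respect to $(\mathbb R^n\setminus F)\cup\{a\}$ and $L(a)$ is the strict derivative of $\bar f$ at $a$ (with respect to $\mathbb R^n$); (vii) if $a\in F$, $R>0$, $L$ is bounded on $B(a,R)\cap F$ and $f$ is Lipschitz continuous on $B(a,R)\cap F$, then $\bar f$ is Lipschitz continuous on $B(a,r)$ for every $r<R$; if $L$ is bounded on $F$ and $f$ is Lipschitz continuous on $F$, then $\bar f$ is Lipschitz continuous on $\mathbb R^n$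.
   Context: $\mathcal L(\mathbb R^n,Y)$ is the normed space of linear maps $\mathbb R^n\to Y$ with operator norm. Baire one means pointwise limit of a sequence of continuous functions. For $A\subset\mathbb R^n$, $g\colon A\to Y$, $a\in A$: $T\in\mathcal L(\mathbb R^n,Y)$ is a relative Fréchet derivative of $g$ at $a$ (w.r.t. $A$) if $a$ is isolated in $A$ or $\lim_{x\to a,x\in A}\|g(x)-g(a)-T(x-a)\|/|x-a|=0$; it is a relative strict derivative at $a$ if $a$ is isolated in $A$ or $\lim \|g(y)-g(x)-T(y-x)\|/|y-x|=0$ as $x\to a$, $y\to a$, $x,y\in A$, $x\ne y$ (with $x=a$ or $y=a$ allowed). For $\alpha\in(0,1]$, $g$ is $\alpha$-Hölder continuous at $a$ (w.r.t. $A$) if $a$ is isolated in $A$ or $\limsup_{x\to a,x\in A}\|g(x)-g(a)\|/|x-a|^\alpha<\infty$; Lipschitz at $a$ means $1$-Hölder at $a$. $B(a,r)$ denotes the open ball. *)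

theory Defs
  imports "HOL-Analysis.Analysis"
begin

definition baire_one_on :: "'a::topological_space set \<Rightarrow> ('a \<Rightarrow> 'b::metric_space) \<Rightarrow> bool" where
  "baire_one_on F L \<longleftrightarrow>
     (\<exists>g :: nat \<Rightarrow> 'a \<Rightarrow> 'b. (\<forall>k. continuous_on F (g k)) \<and> (\<forall>x\<in>F. (\<lambda>k. g k x) \<longlonglongrightarrow> L x))"

text \<open>alpha-Hoelder continuity at a with respect to A (limsup of the nonnegative quotient is finite).\<close>
definition holder_at :: "'a::real_normed_vector set \<Rightarrow> ('a \<Rightarrow> 'b::real_normed_vector) \<Rightarrow> 'a \<Rightarrow> real \<Rightarrow> bool" where
  "holder_at A g a \<alpha> \<longleftrightarrow> \<not> a islimpt A \<or>
     (\<exists>C. eventually (\<lambda>x. norm (g x - g a) / norm (x - a) powr \<alpha> \<le> C) (at a within A))"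

definition lipschitz_at :: "'a::real_normed_vector set \<Rightarrow> ('a \<Rightarrow> 'b::real_normed_vector) \<Rightarrow> 'a \<Rightarrow> bool" where
  "lipschitz_at A g a \<longleftrightarrow> holder_at A g a 1"

definition rel_frechet :: "'a::real_normed_vector set \<Rightarrow> ('a \<Rightarrow> 'b::real_normed_vector) \<Rightarrow> 'a \<Rightarrow> ('a \<Rightarrow>\<^sub>L 'b) \<Rightarrow> bool" where
  "rel_frechet A g a T \<longleftrightarrow> \<not> a islimpt A \<or>
     ((\<lambda>x. norm (g x - g a - blinfun_apply T (x - a)) / norm (x - a)) \<longlongrightarrow> 0) (at a within A)"

definition rel_strict :: "'a::real_normed_vector set \<Rightarrow> ('a \<Rightarrow> 'b::real_normed_vector) \<Rightarrow> 'a \<Rightarrow> ('a \<Rightarrow>\<^sub>L 'b) \<Rightarrow> bool" where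
  "rel_strict A g a T \<longleftrightarrow> \<not> a islimpt A \<or>
     ((\<lambda>(x, y). norm (g y - g x - blinfun_apply T (y - x)) / norm (y - x)) \<longlongrightarrow> 0)
       (at (a, a) within {(x, y). x \<in> A \<and> y \<in> A \<and> x \<noteq> y})"

text \<open>k times continuously (Frechet) differentiable on an open set S, via iterated
  directional derivatives of the Frechet derivative (finite-dimensional domain).\<close>
fun higher_differentiable_on :: "'a::real_normed_vector set \<Rightarrow> ('a \<Rightarrow> 'b::real_normed_vector) \<Rightarrow> nat \<Rightarrow> bool" where
  "higher_differentiable_on S f 0 \<longleftrightarrow> continuous_on S f"
| "higher_differentiable_on S f (Suc n) \<longleftrightarrow>
     (\<forall>x\<in>S. f differentiable (at x)) \<and>
     (\<forall>v. higher_differentiable_on S (\<lambda>x. frechet_derivative f (at x) v) n)"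

definition smooth_on :: "'a::real_normed_vector set \<Rightarrow> ('a \<Rightarrow> 'b::real_normed_vector) \<Rightarrow> bool" where
  "smooth_on S f \<longleftrightarrow> (\<forall>n. higher_differentiable_on S f n)"

end

theory Submission
  imports Defs "HOL-Computational_Algebra.Polynomial"
begin

text \<open>On the complement of \<open>F\<close> one glues affine maps \<open>y \<mapsto> f(p) + A(c) (y - p)\<close> with a Whitney partition of
  unity; \<open>c\<close> runs through the centres of the partition and \<open>p\<close> is a point of \<open>F\<close> closest to \<open>c\<close>. Since the
  gradients of the partition functions sum to 0 and have total size at most a constant over the distance
  to \<open>F\<close>, both the extension and its derivative are controlled by the deviation of the active affine
  maps from any fixed one. Choosing \<open>A = L(p)\<close> would fail for differentiability at points near which \<open>L\<close> is
  unbounded. Instead \<open>A\<close> is built from continuous approximations of \<open>L\<close> so that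
  \<open>\<parallel>A x - L a\<parallel> dist(x, F) = o(|x - a|)\<close> at every \<open>a\<close> in \<open>F\<close>, and this is all that the pointwise properties need.
  Strict differentiability and the Lipschitz property follow from bounds on the derivative off \<open>F\<close> by cutting
  a segment at points where it meets \<open>F\<close>.\<close>


subsection \<open>Calculus of higher differentiability\<close>

text \<open>If \<open>L\<close> is unbounded near \<open>a\<close>, an affine piece with slope
  \<open>L p\<close>, where \<open>p\<close> is a closest point, can be off by
  \<open>norm (L p - L a)\<close> times the distance to \<open>F\<close>, and nothing makes this
  product small against \<open>norm (x - a)\<close>. The Baire property gives only pointwise
  convergence of \<open>g k a\<close> to \<open>L a\<close>, with no uniformity near
  \<open>a\<close>, so two regimes are played against each other. Let \<open>k\<close> be the
  approximation level used at a point \<open>x\<close> near \<open>a\<close>. If the closest point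
  lies within the continuity radius \<open>\<rho> k\<close> of \<open>a\<close>, then
  \<open>g k\<close> hardly varies between the two, and the slope is close to \<open>L a\<close>.
  Otherwise \<open>x\<close> is at least \<open>\<rho> k / 2\<close> away from \<open>a\<close>,
  while the slope, of norm at most \<open>k\<close>, is used only at distances up to
  \<open>\<rho> k / (k + 1)^2\<close> from \<open>F\<close>; the weighted error is then of order
  \<open>norm (x - a) / (k + 1)\<close>. Tying the level to the distance from \<open>F\<close> makes
  both cases work at once for all \<open>a\<close>.\<close>

lemma higher_differentiable_on_cong:
  assumes "open S" "\<And>x. x \<in> S \<Longrightarrow> f x = g x" "higher_differentiable_on S f n"
  shows "higher_differentiable_on S g n"
  using assms(2,3)
proof (induction n arbitrary: f g)
  case 0
  then show ?case by (simp cong: continuous_on_cong)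
next
  case (Suc n)
  have der: "(g has_derivative frechet_derivative f (at x)) (at x)" if "x \<in> S" for x
    using Suc.prems that \<open>open S\<close>
    by (auto intro: has_derivative_transform_within_open[of f] simp: frechet_derivative_works[symmetric])
  then have eq: "frechet_derivative g (at x) = frechet_derivative f (at x)" if "x \<in> S" for x
    using frechet_derivative_at that by metis
  have "higher_differentiable_on S (\<lambda>x. frechet_derivative g (at x) v) n" for v
    by (rule Suc.IH[of "\<lambda>x. frechet_derivative f (at x) v"]) (use Suc.prems eq in auto)
  then show ?case
    using der by (auto simp: differentiable_def)
qed

text \<open>Allows an explicit derivative \<open>f'\<close> in place of
  \<open>frechet_derivative\<close>; most closure properties below are obtained through this
  rule.\<close>

lemma higher_differentiable_on_SucI:
  assumes "open S" "\<And>x. x \<in> S \<Longrightarrow> (f has_derivative f' x) (at x)"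
    and "\<And>v. higher_differentiable_on S (\<lambda>x. f' x v) n"
  shows "higher_differentiable_on S f (Suc n)"
proof -
  have "frechet_derivative f (at x) = f' x" if "x \<in> S" for x
    using assms(2)[OF that] frechet_derivative_at by metis
  then have "higher_differentiable_on S (\<lambda>x. frechet_derivative f (at x) v) n" for v
    using higher_differentiable_on_cong[OF \<open>open S\<close> _ assms(3)[of v]] by simp
  then show ?thesis
    using assms(2) by (auto simp: differentiable_def)
qed

lemma higher_differentiable_on_imp_continuous_on:
  assumes "higher_differentiable_on S f n"
  shows "continuous_on S f"
proof (cases n)
  case (Suc m)
  then show ?thesis
    using assms by (auto intro!: differentiable_imp_continuous_on
        simp: differentiable_on_def differentiable_at_withinI)
qed (use assms in simp)

lemma higher_differentiable_on_SucD:
  "higher_differentiable_on S f (Suc n) \<Longrightarrow> higher_differentiable_on S f n"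
proof (induction n arbitrary: f)
  case 0
  then show ?case
    using higher_differentiable_on_imp_continuous_on higher_differentiable_on.simps(1) by blast
next
  case (Suc n)
  then show ?case by (metis higher_differentiable_on.simps(2))
qed

lemma higher_differentiable_on_has_derivative:
  assumes "higher_differentiable_on S f (Suc n)" "x \<in> S"
  shows "(f has_derivative frechet_derivative f (at x)) (at x)"
  using assms by (simp add: frechet_derivative_works[symmetric])

lemma higher_differentiable_on_const [simp]:
  "open S \<Longrightarrow> higher_differentiable_on S (\<lambda>x. c) n"
proof (induction n arbitrary: c)
  case (Suc n)
  then show ?case
    by (intro higher_differentiable_on_SucI[where f' = "\<lambda>x v. 0"]) auto
qed simp

lemma higher_differentiable_on_blinfun:
  assumes "open S"
  shows "higher_differentiable_on S (\<lambda>x. blinfun_apply T (x - c)) n"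
proof (cases n)
  case 0
  then show ?thesis by (auto intro!: continuous_intros)
next
  case (Suc m)
  then show ?thesis using assms
    by (auto simp del: higher_differentiable_on.simps
        intro!: higher_differentiable_on_SucI[where f' = "\<lambda>x. blinfun_apply T"]
        derivative_eq_intros)
qed

lemma higher_differentiable_on_add:
  assumes "open S" "higher_differentiable_on S f n" "higher_differentiable_on S g n"
  shows "higher_differentiable_on S (\<lambda>x. f x + g x) n"
  using assms(2,3)
proof (induction n arbitrary: f g)
  case 0
  then show ?case by (auto intro: continuous_intros)
next
  case (Suc n)
  show ?case
    by (rule higher_differentiable_on_SucI[OF \<open>open S\<close> has_derivative_add
          [OF higher_differentiable_on_has_derivative[OF Suc.prems(1)]
            higher_differentiable_on_has_derivative[OF Suc.prems(2)]]])
      (use Suc in auto)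
qed

lemma higher_differentiable_on_sum:
  assumes "open S" "finite I" "\<And>i. i \<in> I \<Longrightarrow> higher_differentiable_on S (f i) n"
  shows "higher_differentiable_on S (\<lambda>x. \<Sum>i\<in>I. f i x) n"
  using assms(2,3)
  by (induction I rule: finite_induct) (auto simp: \<open>open S\<close> intro: higher_differentiable_on_add)

lemma higher_differentiable_on_scaleR:
  fixes f :: "'a::real_normed_vector \<Rightarrow> real"
  assumes "open S" "higher_differentiable_on S f n" "higher_differentiable_on S g n"
  shows "higher_differentiable_on S (\<lambda>x. f x *\<^sub>R g x) n"
  using assms(2,3)
proof (induction n arbitrary: f g)
  case 0
  then show ?case by (auto intro: continuous_intros)
next
  case (Suc n)
  note d = higher_differentiable_on_has_derivative[OF Suc.prems(1)]
    higher_differentiable_on_has_derivative[OF Suc.prems(2)]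
  show ?case
  proof (rule higher_differentiable_on_SucI[OF \<open>open S\<close> has_derivative_scaleR[OF d]])
    show "higher_differentiable_on S (\<lambda>x. f x *\<^sub>R frechet_derivative g (at x) v
        + frechet_derivative f (at x) v *\<^sub>R g x) n" for v
      using Suc.prems Suc.prems[THEN higher_differentiable_on_SucD]
      by (intro higher_differentiable_on_add \<open>open S\<close> Suc.IH) auto
  qed
qed

lemma higher_differentiable_on_inverse:
  fixes f :: "'a::real_normed_vector \<Rightarrow> real"
  assumes "open S" "\<And>x. x \<in> S \<Longrightarrow> f x \<noteq> 0" "higher_differentiable_on S f n"
  shows "higher_differentiable_on S (\<lambda>x. inverse (f x)) n"
  using assms(3)
proof (induction n)
  case 0
  then show ?case using assms(2) by (auto intro: continuous_intros)
next
  case (Suc n)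
  note d = higher_differentiable_on_has_derivative[OF Suc.prems]
  have IH: "higher_differentiable_on S (\<lambda>x. inverse (f x)) n"
    using Suc higher_differentiable_on_SucD by blast
  show ?case
  proof (rule higher_differentiable_on_SucI[OF \<open>open S\<close> Deriv.has_derivative_inverse[OF _ d]])
    \<comment> \<open>The derivative of the inverse contains \<open>inverse (f x)\<close> twice, so
      it needs the inverse only to order \<open>n\<close>, which is the induction hypothesis.
      Writing the product with \<open>scaleR\<close> reuses the product rule.\<close>
    have "higher_differentiable_on S
        (\<lambda>x. (- 1) *\<^sub>R (inverse (f x) *\<^sub>R (frechet_derivative f (at x) v *\<^sub>R inverse (f x)))) n" for v
      using Suc.prems IH by (intro higher_differentiable_on_scaleR \<open>open S\<close>) (auto simp: \<open>open S\<close>)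
    then show "higher_differentiable_on S
        (\<lambda>x. - (inverse (f x) * frechet_derivative f (at x) v * inverse (f x))) n" for v
      by (simp add: mult.assoc)
  qed (use assms(2) in auto)
qed

lemma higher_differentiable_on_subset:
  assumes "higher_differentiable_on S f n" "T \<subseteq> S"
  shows "higher_differentiable_on T f n"
  using assms
  by (induction n arbitrary: f) (auto intro: continuous_on_subset)

text \<open>\<open>frechet_derivative f (at x)\<close> does not mention the set, so the local and
  the global derivative are the same function and the induction passes through unchanged.\<close>

lemma higher_differentiable_on_local:
  assumes "open S" "\<And>x. x \<in> S \<Longrightarrow> \<exists>U. open U \<and> x \<in> U \<and> higher_differentiable_on U f n"
  shows "higher_differentiable_on S f n"
  using assms(2)
proof (induction n arbitrary: f)
  case 0
  then show ?case
    by (metis higher_differentiable_on.simps(1) continuous_at_imp_continuous_on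
        continuous_on_eq_continuous_at)
next
  case (Suc n)
  have "higher_differentiable_on S (\<lambda>x. frechet_derivative f (at x) v) n" for v
    by (rule Suc.IH) (use Suc.prems in \<open>metis higher_differentiable_on.simps(2)\<close>)
  moreover have "f differentiable (at x)" if "x \<in> S" for x
    using Suc.prems[OF that] by auto
  ultimately show ?case by simp
qed

section \<open>The cutoff exp(-1/t) and its smoothness\<close>

text \<open>The polynomial is a parameter because these functions form a family closed under
  differentiation; exp(-1/t) alone would not survive the induction.\<close>

definition poly_exp_inv :: "real poly \<Rightarrow> real \<Rightarrow> real" where
  "poly_exp_inv p t = (if t > 0 then poly p (inverse t) * exp (- inverse t) else 0)"

lemma poly_times_exp_neg_tendsto_0: "((\<lambda>u. poly p u * exp (- u)) \<longlongrightarrow> 0) at_top" for p :: "real poly"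
proof -
  have "((\<lambda>u. \<Sum>i\<le>degree p. coeff p i * (u ^ i / exp u)) \<longlongrightarrow> (\<Sum>i\<le>degree p. coeff p i * 0)) at_top"
    by (intro tendsto_sum tendsto_mult tendsto_const tendsto_power_div_exp_0)
  then show ?thesis
    by (simp add: poly_altdef exp_minus field_simps sum_distrib_left sum_divide_distrib)
qed

text \<open>With u = 1/t and du/dt = -u^2, the derivative of p(u) exp(-u) is u^2 (p(u) - p'(u))
  exp(-u); the factor \<open>[:0, 0, 1:]\<close> is u^2.\<close>

lemma poly_exp_inv_has_real_derivative:
  "(poly_exp_inv p has_real_derivative poly_exp_inv ([:0, 0, 1:] * (p - pderiv p)) t) (at t)"
proof (cases t "0 :: real" rule: linorder_cases)
  case less
  have "(poly_exp_inv p has_real_derivative 0) (at t)"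
    by (rule has_field_derivative_transform_within_open[of "\<lambda>_. 0" _ _ "{..<0}"])
      (use less in \<open>auto simp: poly_exp_inv_def\<close>)
  then show ?thesis
    using less by (simp add: poly_exp_inv_def)
next
  case greater
  have "((\<lambda>t. poly p (inverse t) * exp (- inverse t)) has_real_derivative
     (poly (pderiv p) (inverse t) * (- (inverse t * inverse t))) * exp (- inverse t)
     + poly p (inverse t) * (exp (- inverse t) * (inverse t * inverse t))) (at t)"
    using greater by (auto intro!: derivative_eq_intros DERIV_chain2[OF poly_DERIV])
  then have "((\<lambda>t. poly p (inverse t) * exp (- inverse t)) has_real_derivative
     poly_exp_inv ([:0, 0, 1:] * (p - pderiv p)) t) (at t)"
    using greater by (simp add: poly_exp_inv_def algebra_simps)
  then show ?thesis
    by (rule has_field_derivative_transform_within_open[where S = "{0<..}"])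
      (use greater in \<open>auto simp: poly_exp_inv_def\<close>)
next
  case equal
  \<comment> \<open>To the right of 0 the difference quotient is u p(u) exp(-u) with u = 1/t, which
    tends to 0; to the left it is 0.\<close>
  have "((\<lambda>u. poly ([:0, 1:] * p) u * exp (- u)) \<longlongrightarrow> 0) at_top"
    by (rule poly_times_exp_neg_tendsto_0)
  then have "((\<lambda>t. poly ([:0, 1:] * p) (inverse t) * exp (- inverse t)) \<longlongrightarrow> 0) (at_right 0)"
    by (rule filterlim_compose[OF _ filterlim_inverse_at_top_right])
  then have "((\<lambda>t. poly_exp_inv p t / t) \<longlongrightarrow> 0) (at_right 0)"
    by (rule Lim_transform_eventually)
      (auto simp: poly_exp_inv_def eventually_at_filter field_simps)
  moreover have "((\<lambda>t. poly_exp_inv p t / t) \<longlongrightarrow> 0) (at_left 0)"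
    by (rule Lim_transform_eventually[OF tendsto_const])
      (auto simp: poly_exp_inv_def eventually_at_filter)
  ultimately have "((\<lambda>t. poly_exp_inv p t / t) \<longlongrightarrow> 0) (at 0)"
    by (simp add: filterlim_at_split)
  then show ?thesis
    using equal by (simp add: has_field_derivative_iff poly_exp_inv_def)
qed

lemma higher_differentiable_on_poly_exp_inv:
  assumes "open S" "higher_differentiable_on S u n"
  shows "higher_differentiable_on S (\<lambda>x. poly_exp_inv p (u x)) n"
  using assms(2)
proof (induction n arbitrary: p)
  case 0
  have "continuous_on UNIV (poly_exp_inv p)"
    using poly_exp_inv_has_real_derivative DERIV_isCont by (blast intro: continuous_at_imp_continuous_on)
  with 0 show ?case
    using continuous_on_compose2[of UNIV "poly_exp_inv p" S u] by simp
next
  case (Suc n)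
  let ?q = "[:0, 0, 1:] * (p - pderiv p)"
  show ?case
  proof (rule higher_differentiable_on_SucI[OF \<open>open S\<close>])
    show "((\<lambda>x. poly_exp_inv p (u x)) has_derivative
        (\<lambda>v. poly_exp_inv ?q (u x) *\<^sub>R frechet_derivative u (at x) v)) (at x)" if "x \<in> S" for x
      using has_derivative_compose[OF higher_differentiable_on_has_derivative[OF Suc.prems that]
          poly_exp_inv_has_real_derivative[unfolded has_field_derivative_def]] by simp
    show "higher_differentiable_on S
        (\<lambda>x. poly_exp_inv ?q (u x) *\<^sub>R frechet_derivative u (at x) v) n" for v
      using Suc.prems higher_differentiable_on_SucD[OF Suc.prems]
      by (intro higher_differentiable_on_scaleR \<open>open S\<close> Suc.IH) auto
  qed
qed

subsection \<open>Lattice points and Whitney bumps\<close>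

definition bump :: "real \<Rightarrow> real" where
  "bump = poly_exp_inv [:1:]"

lemma bump_nonneg: "0 \<le> bump t"
  and bump_le_1: "bump t \<le> 1"
  and bump_eq_0_iff: "bump t = 0 \<longleftrightarrow> t \<le> 0"
  and bump_ge: "3 \<le> t \<Longrightarrow> exp (- (1/3)) \<le> bump t"
proof -
  show "exp (- (1/3)) \<le> bump t" if "3 \<le> t"
    using that by (simp add: bump_def poly_exp_inv_def field_simps)
qed (auto simp: bump_def poly_exp_inv_def)

lemma bump_derivative:
  obtains b' where "\<And>t. (bump has_real_derivative b' t) (at t)"
    "\<And>t. \<bar>b' t\<bar> \<le> 2" "\<And>t. t \<le> 0 \<Longrightarrow> b' t = 0"
proof
  let ?b = "poly_exp_inv ([:0, 0, 1:] * ([:1:] - pderiv [:1:]))"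
  show "(bump has_real_derivative ?b t) (at t)" for t
    unfolding bump_def by (rule poly_exp_inv_has_real_derivative)
  show "\<bar>?b t\<bar> \<le> 2" for t
  proof (cases "t > 0")
    case True
    \<comment> \<open>With u = 1/t the derivative is u^2 exp(-u), and exp(u) >= u^2 / 2 gives the
      constant 2.\<close>
    have "1 + inverse t + (inverse t)\<^sup>2 / 2 \<le> exp (inverse t)" "inverse t > 0"
      using exp_lower_Taylor_quadratic[of "inverse t"] True by auto
    then have "(inverse t)\<^sup>2 \<le> exp (inverse t) * 2" by linarith
    then have "(inverse t)\<^sup>2 * exp (- inverse t) \<le> exp (inverse t) * 2 * exp (- inverse t)"
      by (intro mult_right_mono) auto
    then have "(inverse t)\<^sup>2 * exp (- inverse t) \<le> 2"
      using exp_minus_inverse[of "inverse t"] by (simp add: mult.commute mult.left_commute del: power_inverse)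
    then show ?thesis
      using True by (simp add: poly_exp_inv_def pderiv_pCons power2_eq_square abs_mult)
  qed (simp add: poly_exp_inv_def)
  show "?b t = 0" if "t \<le> 0" for t
    using that by (simp add: poly_exp_inv_def)
qed

section \<open>Lattice points: covering and counting\<close>

definition integer_lattice :: "'a::euclidean_space set" where
  "integer_lattice = {z. \<forall>b\<in>Basis. z \<bullet> b \<in> \<int>}"

lemma integer_lattice_diff:
  "x \<in> integer_lattice \<Longrightarrow> y \<in> integer_lattice \<Longrightarrow> x - y \<in> integer_lattice"
  by (auto simp: integer_lattice_def inner_diff_left)

text \<open>Rounding down costs at most 1 per coordinate. The crude bound is harmless: mesh
  \<open>s / DIM('a)\<close> turns it into a covering by balls of radius \<open>s\<close>.\<close>

lemma integer_lattice_near: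
  fixes x :: "'a::euclidean_space"
  obtains z where "z \<in> integer_lattice" "norm (x - z) \<le> DIM('a)"
proof
  let ?z = "\<Sum>b\<in>Basis. of_int \<lfloor>x \<bullet> b\<rfloor> *\<^sub>R b"
  have z: "?z \<bullet> b = of_int \<lfloor>x \<bullet> b\<rfloor>" if "b \<in> Basis" for b
    using that by (simp add: inner_sum_left inner_Basis if_distrib sum.delta cong: if_cong)
  show "?z \<in> integer_lattice"
    by (simp add: integer_lattice_def z)
  have "norm (x - ?z) \<le> (\<Sum>b\<in>Basis. \<bar>(x - ?z) \<bullet> b\<bar>)"
    by (rule norm_le_l1)
  also have "\<dots> \<le> (\<Sum>b\<in>(Basis :: 'a set). 1)"
  proof (rule sum_mono)
    show "\<bar>(x - ?z) \<bullet> b\<bar> \<le> 1" if "b \<in> Basis" for b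
      unfolding inner_diff_left z[OF that] by linarith
  qed
  finally show "norm (x - ?z) \<le> DIM('a)" by simp
qed

lemma finite_integer_lattice_cball_0:
  "finite (integer_lattice \<inter> cball (0 :: 'a::euclidean_space) r)"
proof (rule finite_subset)
  let ?g = "\<lambda>g. \<Sum>b\<in>(Basis :: 'a set). of_int (g b) *\<^sub>R b"
  let ?B = "PiE (Basis :: 'a set) (\<lambda>_. {-\<lceil>r\<rceil>..\<lceil>r\<rceil>})"
  show "finite (?g ` ?B)"
    by (intro finite_imageI finite_PiE) auto
  show "integer_lattice \<inter> cball 0 r \<subseteq> ?g ` ?B"
  proof
    fix z :: 'a assume z: "z \<in> integer_lattice \<inter> cball 0 r"
    have int: "of_int \<lfloor>z \<bullet> b\<rfloor> = z \<bullet> b" if "b \<in> Basis" for b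
      using z that by (auto simp: integer_lattice_def)
    have "\<lfloor>z \<bullet> b\<rfloor> \<in> {-\<lceil>r\<rceil>..\<lceil>r\<rceil>}" if "b \<in> Basis" for b
    proof -
      have "\<bar>z \<bullet> b\<bar> \<le> r"
        using Basis_le_norm[OF that, of z] z by simp
      then show ?thesis
        by (simp add: le_floor_iff floor_le_iff) linarith
    qed
    moreover have "z = (\<Sum>b\<in>Basis. of_int \<lfloor>z \<bullet> b\<rfloor> *\<^sub>R b)"
      by (simp add: int euclidean_representation)
    ultimately show "z \<in> ?g ` ?B"
      by (intro image_eqI[where x = "restrict (\<lambda>b. \<lfloor>z \<bullet> b\<rfloor>) Basis"]) auto
  qed
qed

text \<open>Translating along the lattice makes the bound independent of the centre.\<close>
lemma card_integer_lattice_cball: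
  obtains N where "\<And>y :: 'a::euclidean_space. finite (integer_lattice \<inter> cball y r)"
    "\<And>y :: 'a. card (integer_lattice \<inter> cball y r) \<le> N"
proof
  let ?A = "integer_lattice \<inter> cball (0 :: 'a) (r + DIM('a))"
  fix y :: 'a
  obtain z where z: "z \<in> integer_lattice" "norm (y - z) \<le> DIM('a)"
    by (rule integer_lattice_near)
  have sub: "(\<lambda>x. x - z) ` (integer_lattice \<inter> cball y r) \<subseteq> ?A"
  proof (rule image_subsetI)
    fix x assume x: "x \<in> integer_lattice \<inter> cball y r"
    have "norm (x - z) \<le> norm (x - y) + norm (y - z)"
      using norm_triangle_ineq[of "x - y" "y - z"] by simp
    with x z show "x - z \<in> ?A"
      by (auto simp: integer_lattice_diff dist_norm norm_minus_commute)
  qed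
  have inj: "inj_on (\<lambda>x. x - z) (integer_lattice \<inter> cball y r)"
    by (simp add: inj_on_def)
  show "finite (integer_lattice \<inter> cball y r)"
    using inj_on_finite[OF inj sub finite_integer_lattice_cball_0] .
  show "card (integer_lattice \<inter> cball y r) \<le> card ?A"
    using card_inj_on_le[OF inj sub finite_integer_lattice_cball_0] .
qed

section \<open>Whitney balls: scales, centres and bounded overlap\<close>

text \<open>Balls on rescaled lattices replace Whitney cubes: overlaps are allowed, so no maximality
  or disjointness has to be arranged. Dyadic scales keep the number of scales at a given distance
  bounded, and the window from 8 to 32 leaves room for the pair built in
  \<open>whitney_index_cover\<close>.\<close>

definition whitney_index :: "'a::euclidean_space set \<Rightarrow> ('a \<times> real) set" where
  "whitney_index F = {(c, s). (\<exists>m :: int. s = 2 powr m) \<and>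
     (\<exists>z\<in>integer_lattice. c = (s / DIM('a)) *\<^sub>R z) \<and> 8 * s \<le> infdist c F \<and> infdist c F \<le> 32 * s}"

text \<open>Off \<open>F\<close>, a finite superset of all indices whose bump is nonzero somewhere
  in the ball of radius \<open>infdist x F / 4\<close> around \<open>x\<close>. Freezing it on that
  ball turns locally finite sums into finite ones that can be differentiated termwise.\<close>

definition whitney_near :: "'a::euclidean_space set \<Rightarrow> 'a \<Rightarrow> ('a \<times> real) set" where
  "whitney_near F x = {(c, s) \<in> whitney_index F. dist x c \<le> 14 * s \<and>
     infdist x F \<le> 50 * s \<and> s \<le> infdist x F}"

lemma infdist_le_add_dist: "infdist x F \<le> infdist y F + dist x y"
  using infdist_triangle[of x F y] by simp

lemma whitney_near_card:
  fixes F :: "'a::euclidean_space set"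
  obtains N where "\<And>x. infdist x F > 0 \<Longrightarrow> finite (whitney_near F x)"
    "\<And>x. infdist x F > 0 \<Longrightarrow> card (whitney_near F x) \<le> N"
proof -
  let ?n = "real DIM('a)"
  obtain K where K: "\<And>y :: 'a. finite (integer_lattice \<inter> cball y (14 * ?n))"
    "\<And>y :: 'a. card (integer_lattice \<inter> cball y (14 * ?n)) \<le> K"
    using card_integer_lattice_cball[where r = "14 * ?n" and 'a = 'a] by blast
  have main: "finite (whitney_near F x) \<and> card (whitney_near F x) \<le> 7 * K" if d: "infdist x F > 0" for x
  proof -
    \<comment> \<open>Since \<open>s <= infdist x F <= 50 * s < 64 * s\<close>, the exponent of the
      scale lies in \<open>{l-6..l}\<close>: seven scales with at most \<open>K\<close> centres
      each.\<close>
    define l where "l = \<lfloor>log 2 (infdist x F)\<rfloor>"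
    define Z where "Z m = integer_lattice \<inter> cball ((?n / 2 powr real_of_int m) *\<^sub>R x) (14 * ?n)" for m :: int
    define g where "g = (\<lambda>(m :: int, z :: 'a). ((2 powr real_of_int m / ?n) *\<^sub>R z, 2 powr real_of_int m))"
    have sub: "whitney_near F x \<subseteq> g ` (SIGMA m:{l-6..l}. Z m)"
    proof clarify
      fix c s assume "(c, s) \<in> whitney_near F x"
      then obtain m :: int and z where m: "s = 2 powr m" and z: "z \<in> integer_lattice"
        and c: "c = (s / ?n) *\<^sub>R z" and near: "dist x c \<le> 14 * s"
        and s: "infdist x F \<le> 50 * s" "s \<le> infdist x F"
        by (auto simp: whitney_near_def whitney_index_def)
      have "real_of_int m \<le> log 2 (infdist x F)"
        using s(2) d by (simp add: m le_log_iff)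
      moreover have "log 2 (infdist x F) \<le> real_of_int m + 6"
      proof -
        have "s > 0" "2 powr (m + 6) = 64 * s"
          by (simp_all add: m powr_add)
        then have "infdist x F \<le> 2 powr (m + 6)"
          using s(1) by linarith
        then show ?thesis using d by (simp add: log_le_iff)
      qed
      ultimately have "m \<in> {l-6..l}"
        unfolding l_def by (simp add: le_floor_iff) linarith
      \<comment> \<open>Magnifying by \<open>?n / s\<close> sends the centres of scale
        \<open>s\<close> to lattice points in a ball of radius \<open>14 * ?n\<close>, the same for
        all scales.\<close>
      moreover have "z \<in> Z m"
      proof -
        have "s > 0" by (simp add: m)
        then have "(?n / s) *\<^sub>R x - z = (?n / s) *\<^sub>R (x - c)"
          by (simp add: c algebra_simps)
        then have "dist ((?n / s) *\<^sub>R x) z = (?n / s) * dist x c"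
          using \<open>s > 0\<close> by (simp add: dist_norm)
        also have "\<dots> \<le> (?n / s) * (14 * s)"
          using \<open>s > 0\<close> near by (intro mult_left_mono) auto
        finally show ?thesis
          using \<open>s > 0\<close> z by (simp add: Z_def m)
      qed
      ultimately show "(c, s) \<in> g ` (SIGMA m:{l-6..l}. Z m)"
        by (intro image_eqI[where x = "(m, z)"]) (auto simp: g_def c m)
    qed
    have fin: "finite (SIGMA m:{l-6..l}. Z m)"
      using K by (intro finite_SigmaI) (auto simp: Z_def)
    have "card (whitney_near F x) \<le> card (SIGMA m:{l-6..l}. Z m)"
      using surj_card_le[OF fin sub] .
    also have "\<dots> = (\<Sum>m\<in>{l-6..l}. card (Z m))"
      using K by (intro card_SigmaI) (auto simp: Z_def)
    also have "\<dots> \<le> (\<Sum>m\<in>{l-6..l}. K)"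
      using K by (intro sum_mono) (auto simp: Z_def)
    also have "\<dots> = 7 * K" by simp
    finally show ?thesis
      using finite_surj[OF fin sub] by simp
  qed
  show ?thesis
    by (rule that[of "7 * K"]) (use main in auto)
qed

lemma whitney_index_cover:
  fixes F :: "'a::euclidean_space set"
  assumes "infdist x F > 0"
  obtains c s where "(c, s) \<in> whitney_index F" "norm (x - c) \<le> s" "s > 0"
proof -
  let ?n = "real DIM('a)"
  \<comment> \<open>Aiming at a tenth of the distance gives
    \<open>10 * s <= infdist x F <= 20 * s\<close>; moving to a centre within \<open>s\<close>
    leaves a distance between \<open>9 * s\<close> and \<open>21 * s\<close>, inside the window of
    the index set.\<close>
  define m where "m = \<lfloor>log 2 (infdist x F / 10)\<rfloor>"
  define s :: real where "s = 2 powr m"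
  have n: "?n > 0" by simp
  have "s > 0" by (simp add: s_def)
  have "10 * s \<le> infdist x F"
  proof -
    have "real_of_int m \<le> log 2 (infdist x F / 10)"
      by (simp add: m_def)
    then show ?thesis
      using assms by (simp add: s_def le_log_iff)
  qed
  have "infdist x F \<le> 20 * s"
  proof -
    have "log 2 (infdist x F / 10) \<le> real_of_int m + 1"
      by (simp add: m_def)
    then have "infdist x F / 10 \<le> 2 powr (real_of_int m + 1)"
      using assms by (simp add: log_le_iff)
    then show ?thesis
      by (simp add: s_def powr_add)
  qed
  obtain z where z: "z \<in> integer_lattice" "norm ((?n / s) *\<^sub>R x - z) \<le> ?n"
    by (rule integer_lattice_near)
  define c where "c = (s / ?n) *\<^sub>R z"
  have "x - c = (s / ?n) *\<^sub>R ((?n / s) *\<^sub>R x - z)"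
    using \<open>s > 0\<close> by (simp add: c_def algebra_simps)
  then have "norm (x - c) = (s / ?n) * norm ((?n / s) *\<^sub>R x - z)"
    using \<open>s > 0\<close> by simp
  also have "\<dots> \<le> (s / ?n) * ?n"
    using \<open>s > 0\<close> z by (intro mult_left_mono) auto
  finally have near: "norm (x - c) \<le> s" by simp
  have "8 * s \<le> infdist c F" "infdist c F \<le> 32 * s"
    using infdist_le_add_dist[of x F c] infdist_le_add_dist[of c F x] near
      \<open>10 * s \<le> infdist x F\<close> \<open>infdist x F \<le> 20 * s\<close> \<open>s > 0\<close>
    by (auto simp: dist_norm norm_minus_commute)
  then have "(c, s) \<in> whitney_index F"
    using z by (auto simp: whitney_index_def c_def s_def)
  with near \<open>s > 0\<close> that show ?thesis by blast
qed

text \<open>The inner product keeps the squared distance polynomial, hence smooth at the centre too.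
  The offset 4 makes the bump vanish from radius \<open>2 * s\<close> on, and within radius
  \<open>s\<close> the argument is at least 3.\<close>

definition whitney_bump :: "'a::real_inner \<times> real \<Rightarrow> 'a \<Rightarrow> real" where
  "whitney_bump i x = bump (4 - (x - fst i) \<bullet> (x - fst i) / (snd i)\<^sup>2)"

lemma whitney_bump_nonneg: "0 \<le> whitney_bump i x"
  and whitney_bump_le_1: "whitney_bump i x \<le> 1"
  by (simp_all add: whitney_bump_def bump_nonneg bump_le_1)

lemma whitney_bump_eq_0_iff:
  "s > 0 \<Longrightarrow> whitney_bump (c, s) x = 0 \<longleftrightarrow> 2 * s \<le> norm (x - c)"
  using abs_le_square_iff[of "2 * s" "norm (x - c)"]
  by (simp add: whitney_bump_def bump_eq_0_iff field_simps power2_norm_eq_inner)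

lemma whitney_bump_ge:
  assumes "s > 0" "norm (x - c) \<le> s"
  shows "exp (- (1/3)) \<le> whitney_bump (c, s) x"
proof -
  have "(norm (x - c))\<^sup>2 \<le> s\<^sup>2"
    using assms by (intro power_mono) auto
  then show ?thesis
    using assms by (auto simp: whitney_bump_def power2_norm_eq_inner field_simps intro!: bump_ge)
qed

lemma higher_differentiable_on_whitney_bump:
  fixes S :: "'a::real_inner set"
  assumes "open S"
  shows "higher_differentiable_on S (whitney_bump i) n"
proof -
  have inner: "higher_differentiable_on S (\<lambda>x. (x - c) \<bullet> v) n" for c v n
  proof (cases n)
    case (Suc m)
    then show ?thesis using assms
      by (auto simp del: higher_differentiable_on.simps
          intro!: higher_differentiable_on_SucI[where f' = "\<lambda>x h. h \<bullet> v"] derivative_eq_intros)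
  qed (auto intro!: continuous_intros)
  have square: "higher_differentiable_on S (\<lambda>x. (x - c) \<bullet> (x - c)) n" for c n
  proof (cases n)
    case (Suc m)
    have "((\<lambda>x. (x - c) \<bullet> (x - c)) has_derivative (\<lambda>h. (x - c) \<bullet> h + (x - c) \<bullet> h)) (at x)" for x
      by (auto intro!: derivative_eq_intros simp: inner_commute)
    moreover have "higher_differentiable_on S (\<lambda>x. (x - c) \<bullet> v + (x - c) \<bullet> v) m" for v
      by (intro higher_differentiable_on_add assms inner)
    ultimately show ?thesis
      unfolding Suc using assms by (intro higher_differentiable_on_SucI) auto
  qed (auto intro!: continuous_intros)
  have "higher_differentiable_on S (\<lambda>x. 4 + (- 1 / (snd i)\<^sup>2) *\<^sub>R ((x - fst i) \<bullet> (x - fst i))) n"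
    by (intro higher_differentiable_on_add higher_differentiable_on_scaleR assms square
        higher_differentiable_on_const)
  then show ?thesis
    unfolding whitney_bump_def bump_def
    using assms by (intro higher_differentiable_on_poly_exp_inv) simp_all
qed

text \<open>The chain rule gives a factor 2 from \<open>bump\<close> and 2 |x - c| / s^2 from the
  quadratic; for |x - c| <= 2 s the product is at most 8 / s. Beyond that radius the quadratic
  factor grows, but the derivative of \<open>bump\<close> is 0.\<close>

lemma whitney_bump_derivative_bound:
  assumes "s > 0"
  obtains f' where "(whitney_bump (c, s) has_derivative f') (at x)" "\<And>v. \<bar>f' v\<bar> \<le> 8 / s * norm v"
proof -
  obtain b' where b': "\<And>t. (bump has_real_derivative b' t) (at t)"
    "\<And>t. \<bar>b' t\<bar> \<le> 2" "\<And>t. t \<le> 0 \<Longrightarrow> b' t = 0"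
    by (rule bump_derivative) blast
  let ?t = "4 - (x - c) \<bullet> (x - c) / s\<^sup>2"
  let ?f = "\<lambda>v. b' ?t * (- (2 * ((x - c) \<bullet> v)) / s\<^sup>2)"
  have inner: "((\<lambda>x. 4 - (x - c) \<bullet> (x - c) / s\<^sup>2) has_derivative (\<lambda>v. - (2 * ((x - c) \<bullet> v)) / s\<^sup>2)) (at x)"
    using assms by (auto intro!: derivative_eq_intros simp: inner_commute field_simps eval_nat_numeral)
  have "(whitney_bump (c, s) has_derivative ?f) (at x)"
    using has_derivative_compose[OF inner b'(1)[unfolded has_field_derivative_def]]
    by (simp add: whitney_bump_def[abs_def])
  moreover have "\<bar>?f v\<bar> \<le> 8 / s * norm v" for v
  proof (cases "norm (x - c) \<le> 2 * s")
    case True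
    have "\<bar>(x - c) \<bullet> v\<bar> \<le> 2 * s * norm v"
      using Cauchy_Schwarz_ineq2[of "x - c" v] True
      by (meson mult_right_mono norm_ge_zero order_trans)
    then have "\<bar>b' ?t\<bar> * \<bar>(x - c) \<bullet> v\<bar> \<le> 2 * (2 * s * norm v)"
      using b'(2) by (intro mult_mono) auto
    then show ?thesis
      using assms by (simp add: abs_mult field_simps power2_eq_square)
  next
    case False
    then have "bump ?t = 0"
      using whitney_bump_eq_0_iff[OF assms, of c x] by (simp add: whitney_bump_def)
    then show ?thesis
      using b'(3) assms by (simp add: bump_eq_0_iff)
  qed
  ultimately show ?thesis by (rule that)
qed

subsection \<open>Whitney partition of unity\<close>

lemma whitney_index_pos: "(c, s) \<in> whitney_index F \<Longrightarrow> s > 0"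
  by (auto simp: whitney_index_def)

lemma whitney_bump_support:
  assumes "(c, s) \<in> whitney_index F" "whitney_bump (c, s) y \<noteq> 0"
  shows "dist y c < 2 * s" "6 * s \<le> infdist y F" "infdist y F \<le> 34 * s"
proof -
  show d: "dist y c < 2 * s"
    using assms(2) whitney_bump_eq_0_iff[OF whitney_index_pos[OF assms(1)], of c y]
    by (simp add: dist_norm)
  show "6 * s \<le> infdist y F" "infdist y F \<le> 34 * s"
    using assms(1) d infdist_le_add_dist[of y F c] infdist_le_add_dist[of c F y]
    by (auto simp: whitney_index_def dist_commute)
qed

text \<open>At \<open>y\<close> the bounds are 2 s, 6 s and 34 s. The distances of \<open>x\<close>
  and \<open>y\<close> to \<open>F\<close> differ by less than a quarter of
  \<open>infdist x F\<close>, so at \<open>x\<close> they become 136/3 s < 50 s from above, 24/5 s >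
  s from below, and 34/3 s + 2 s < 14 s for the centre. This is the origin of the constants in
  \<open>whitney_near\<close>.\<close>

lemma whitney_bump_support_near:
  assumes "i \<in> whitney_index F" "whitney_bump i y \<noteq> 0" "dist x y < infdist x F / 4"
  shows "i \<in> whitney_near F x"
proof (cases i)
  case (Pair c s)
  note supp = whitney_bump_support[OF assms(1,2)[unfolded Pair]]
  have "infdist x F \<le> infdist y F + dist x y" "infdist y F \<le> infdist x F + dist x y"
    using infdist_le_add_dist[of x F y] infdist_le_add_dist[of y F x] by (simp_all add: dist_commute)
  then have "infdist x F \<le> 50 * s" "s \<le> infdist x F" "dist x c \<le> 14 * s"
    using supp assms(3) dist_triangle[of x c y] infdist_nonneg[of x F] by linarith+
  then show ?thesis
    using assms(1) by (simp add: whitney_near_def Pair)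
qed

text \<open>The index set is infinite in general and \<open>sum\<close> over an infinite set is 0,
  hence the restriction to nonzero terms.\<close>

definition whitney_total :: "'a::euclidean_space set \<Rightarrow> 'a \<Rightarrow> real" where
  "whitney_total F x = (\<Sum>i \<in> {i \<in> whitney_index F. whitney_bump i x \<noteq> 0}. whitney_bump i x)"

definition whitney_fun :: "'a::euclidean_space set \<Rightarrow> 'a \<times> real \<Rightarrow> 'a \<Rightarrow> real" where
  "whitney_fun F i x = inverse (whitney_total F x) *\<^sub>R whitney_bump i x"

lemma whitney_near_finite: "infdist x F > 0 \<Longrightarrow> finite (whitney_near F x)"
  using whitney_near_card by metis

lemma whitney_total_eq:
  assumes "dist x y < infdist x F / 4"
  shows "whitney_total F y = (\<Sum>i \<in> whitney_near F x. whitney_bump i y)"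
  unfolding whitney_total_def
proof (rule sum.mono_neutral_left)
  show "finite (whitney_near F x)"
    using assms zero_le_dist[of x y] by (intro whitney_near_finite) linarith
  show "{i \<in> whitney_index F. whitney_bump i y \<noteq> 0} \<subseteq> whitney_near F x"
    using whitney_bump_support_near assms by blast
qed (auto simp: whitney_near_def)

text \<open>One ball of the covering already contributes this much. Uniformity in \<open>x\<close>
  lets the normalised functions keep derivative bounds of order
  \<open>1 / infdist x F\<close>.\<close>

lemma whitney_total_ge:
  assumes "infdist x F > 0"
  shows "exp (- (1/3)) \<le> whitney_total F x"
proof -
  obtain c s where cs: "(c, s) \<in> whitney_index F" "norm (x - c) \<le> s" "s > 0"
    using whitney_index_cover[OF assms] .
  have ge: "exp (- (1/3)) \<le> whitney_bump (c, s) x"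
    by (rule whitney_bump_ge[OF cs(3,2)])
  then have "whitney_bump (c, s) x \<noteq> 0"
    using exp_gt_zero[of "- (1/3) :: real"] by linarith
  then have "(c, s) \<in> whitney_near F x"
    using cs(1) assms by (intro whitney_bump_support_near[where y = x]) auto
  then have "whitney_bump (c, s) x \<le> (\<Sum>i \<in> whitney_near F x. whitney_bump i x)"
    using whitney_near_finite[OF assms] by (intro member_le_sum) (auto simp: whitney_bump_nonneg)
  with ge show ?thesis
    using assms by (simp add: whitney_total_eq[where x = x])
qed

lemma whitney_total_pos: "infdist x F > 0 \<Longrightarrow> whitney_total F x > 0"
  using whitney_total_ge[of x F] exp_gt_zero[of "- (1/3) :: real"] by linarith

lemma infdist_pos_of_dist_less:
  assumes "dist x y < infdist x F / 4"
  shows "infdist y F > 0"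
  using assms infdist_le_add_dist[of x F y] zero_le_dist[of x y] by linarith

lemma higher_differentiable_on_whitney_fun:
  assumes "closed F" "F \<noteq> {}"
  shows "higher_differentiable_on (- F) (whitney_fun F i) n"
proof (rule higher_differentiable_on_local)
  fix x assume "x \<in> - F"
  then have d: "infdist x F > 0"
    using assms in_closed_iff_infdist_zero[of F x] infdist_nonneg[of x F] by force
  let ?U = "ball x (infdist x F / 4)"
  have "higher_differentiable_on ?U (\<lambda>y. \<Sum>i \<in> whitney_near F x. whitney_bump i y) n"
    by (intro higher_differentiable_on_sum higher_differentiable_on_whitney_bump
        whitney_near_finite d open_ball)
  then have "higher_differentiable_on ?U (whitney_total F) n"
    by (rule higher_differentiable_on_cong[OF open_ball, rotated])
      (simp add: whitney_total_eq)
  moreover have "whitney_total F y \<noteq> 0" if "y \<in> ?U" for y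
    using whitney_total_pos[OF infdist_pos_of_dist_less[of x y F]] that by simp
  ultimately have "higher_differentiable_on ?U (whitney_fun F i) n"
    unfolding whitney_fun_def[abs_def]
    by (intro higher_differentiable_on_scaleR higher_differentiable_on_inverse
        higher_differentiable_on_whitney_bump open_ball)
  then show "\<exists>U. open U \<and> x \<in> U \<and> higher_differentiable_on U (whitney_fun F i) n"
    using d by (intro exI[of _ ?U]) auto
qed (use assms in auto)

lemma whitney_fun_nonneg: "0 \<le> whitney_fun F i x"
  by (simp add: whitney_fun_def whitney_total_def sum_nonneg whitney_bump_nonneg)

lemma sum_whitney_fun:
  assumes "dist x y < infdist x F / 4"
  shows "(\<Sum>i \<in> whitney_near F x. whitney_fun F i y) = 1"
  using whitney_total_pos[OF infdist_pos_of_dist_less[OF assms]]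
  by (simp add: whitney_fun_def flip: sum_distrib_left whitney_total_eq[OF assms])

text \<open>On the support the distance to \<open>F\<close> is at least \<open>6 * s\<close>, while
  the centre is closer than \<open>2 * s\<close>.\<close>

lemma whitney_fun_support:
  assumes "i \<in> whitney_index F" "whitney_fun F i x \<noteq> 0"
  shows "dist x (fst i) \<le> infdist x F / 3"
  using whitney_bump_support[of "fst i" "snd i" F x] assms by (auto simp: whitney_fun_def)

lemma whitney_fun_derivative_bound:
  fixes F :: "'a::euclidean_space set"
  obtains C where "C \<ge> 0" "\<And>x. infdist x F > 0 \<Longrightarrow> \<exists>D.
      (\<forall>i \<in> whitney_near F x. (whitney_fun F i has_derivative D i) (at x)) \<and>
      (\<forall>v. (\<Sum>i \<in> whitney_near F x. \<bar>D i v\<bar>) \<le> C / infdist x F * norm v)"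
proof -
  obtain N where N: "\<And>x. infdist x F > 0 \<Longrightarrow> card (whitney_near F x) \<le> N"
    using whitney_near_card by metis
  define e where "e = exp (- (1/3) :: real)"
  have e: "e > 0" by (simp add: e_def)
  \<comment> \<open>A near bump has derivative at most \<open>8 / s\<close>, and
    \<open>s >= infdist x F / 50\<close> makes this \<open>400 / infdist x F\<close>. The quotient
    rule adds the derivative of the total, up to \<open>N\<close> times larger, over
    \<open>e^2\<close>; the outer \<open>N\<close> sums over the near indices.\<close>
  define C where "C = N * (400 / e + N * 400 / e\<^sup>2)"
  have "C \<ge> 0" using e by (simp add: C_def)
  moreover have "\<exists>D. (\<forall>i \<in> whitney_near F x. (whitney_fun F i has_derivative D i) (at x)) \<and>
      (\<forall>v. (\<Sum>i \<in> whitney_near F x. \<bar>D i v\<bar>) \<le> C / infdist x F * norm v)"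
    if d: "infdist x F > 0" for x
  proof -
    let ?J = "whitney_near F x"
    let ?d = "infdist x F"
    have "\<exists>f'. (whitney_bump i has_derivative f') (at x) \<and> (\<forall>v. \<bar>f' v\<bar> \<le> 400 / ?d * norm v)"
      if "i \<in> ?J" for i
    proof (cases i)
      case (Pair c s)
      have s: "s > 0" "?d \<le> 50 * s"
        using that whitney_index_pos by (auto simp: whitney_near_def Pair)
      obtain f' where f': "(whitney_bump (c, s) has_derivative f') (at x)"
        "\<And>v. \<bar>f' v\<bar> \<le> 8 / s * norm v"
        by (rule whitney_bump_derivative_bound[OF s(1)]) blast
      have "8 / s * norm v \<le> 400 / ?d * norm v" for v :: 'a
        using s d by (intro mult_right_mono) (auto simp: field_simps)
      with f' show ?thesis
        unfolding Pair by (meson order_trans)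
    qed
    then obtain E where E: "\<And>i. i \<in> ?J \<Longrightarrow> (whitney_bump i has_derivative E i) (at x)"
      "\<And>i v. i \<in> ?J \<Longrightarrow> \<bar>E i v\<bar> \<le> 400 / ?d * norm v"
      by metis
    define G where "G v = (\<Sum>i\<in>?J. E i v)" for v
    have G: "\<bar>G v\<bar> \<le> N * (400 / ?d * norm v)" for v
    proof -
      have "\<bar>G v\<bar> \<le> card ?J * (400 / ?d * norm v)"
        unfolding G_def real_norm_def[symmetric] using E(2) by (intro sum_norm_bound) simp
      also have "\<dots> \<le> N * (400 / ?d * norm v)"
        using N[OF d] d by (intro mult_right_mono) auto
      finally show ?thesis .
    qed
    let ?S = "whitney_total F"
    have S: "e \<le> ?S x" "?S x > 0"
      using whitney_total_ge[OF d] whitney_total_pos[OF d] by (auto simp: e_def)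
    have "((\<lambda>y. \<Sum>i\<in>?J. whitney_bump i y) has_derivative G) (at x)"
      unfolding G_def using E(1) by (intro has_derivative_sum)
    then have dS: "(?S has_derivative G) (at x)"
      by (rule has_derivative_transform_within_open[where s = "ball x (?d / 4)"])
        (use d in \<open>auto simp: whitney_total_eq\<close>)
    define D where "D i v = inverse (?S x) * E i v - inverse (?S x) * G v * inverse (?S x) * whitney_bump i x"
      for i v
    have "(whitney_fun F i has_derivative D i) (at x)" if "i \<in> ?J" for i
    proof -
      have "((\<lambda>y. inverse (?S y) *\<^sub>R whitney_bump i y) has_derivative
          (\<lambda>v. inverse (?S x) *\<^sub>R E i v + - (inverse (?S x) * G v * inverse (?S x)) *\<^sub>R whitney_bump i x)) (at x)"
        using S by (intro has_derivative_scaleR E(1) that Deriv.has_derivative_inverse dS) auto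
      then show ?thesis
        by (simp add: whitney_fun_def[abs_def] D_def[abs_def])
    qed
    moreover have "(\<Sum>i\<in>?J. \<bar>D i v\<bar>) \<le> C / ?d * norm v" for v
    proof -
      have inv: "inverse (?S x) \<le> inverse e"
        using S e by (intro le_imp_inverse_le) auto
      have "\<bar>D i v\<bar> \<le> (400 / e + N * 400 / e\<^sup>2) / ?d * norm v" if "i \<in> ?J" for i
      proof -
        have "\<bar>inverse (?S x) * E i v\<bar> \<le> inverse e * (400 / ?d * norm v)"
          unfolding abs_mult using E(2)[OF that] inv S e by (intro mult_mono) auto
        moreover have "\<bar>inverse (?S x) * G v * inverse (?S x) * whitney_bump i x\<bar>
            \<le> inverse e * (N * (400 / ?d * norm v)) * inverse e * 1"
          unfolding abs_mult
          using G[of v] inv S e d whitney_bump_le_1[of i x] whitney_bump_nonneg[of i x]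
          by (intro mult_mono) auto
        ultimately have "\<bar>D i v\<bar> \<le> inverse e * (400 / ?d * norm v)
            + inverse e * (N * (400 / ?d * norm v)) * inverse e * 1"
          unfolding D_def by linarith
        then show ?thesis
          using e d by (simp add: field_simps power2_eq_square)
      qed
      then have "(\<Sum>i\<in>?J. \<bar>D i v\<bar>) \<le> card ?J * ((400 / e + N * 400 / e\<^sup>2) / ?d * norm v)"
        by (rule sum_bounded_above)
      also have "\<dots> \<le> N * ((400 / e + N * 400 / e\<^sup>2) / ?d * norm v)"
        using N[OF d] d e by (intro mult_right_mono) auto
      finally show ?thesis by (simp add: C_def)
    qed
    ultimately show ?thesis by blast
  qed
  ultimately show ?thesis by (rule that)
qed

subsection \<open>Extending a Baire one function off a closed set\<close>

text \<open>Level \<open>k\<close> is permitted at distances up to \<open>r k\<close>, and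
  \<open>K t\<close> stops at the first level whose successor is not permitted at \<open>t\<close>.
  Such a level exists because \<open>r\<close> tends to 0, and \<open>K t\<close> grows without
  bound as \<open>t\<close> tends to 0 because every \<open>r k\<close> is positive.\<close>

lemma slow_index:
  fixes r :: "nat \<Rightarrow> real"
  assumes "\<And>k. r k > 0" "r \<longlonglongrightarrow> 0"
  obtains K :: "real \<Rightarrow> nat" where "\<And>m. \<exists>\<delta>>0. \<forall>t. 0 < t \<and> t < \<delta> \<longrightarrow> m \<le> K t"
    "\<And>t. 0 < t \<Longrightarrow> 0 < K t \<Longrightarrow> t \<le> r (K t)"
proof -
  define K where "K t = (LEAST k. r (Suc k) < t)" for t
  have ex: "\<exists>k. r (Suc k) < t" if "t > 0" for t
  proof -
    have "eventually (\<lambda>k. r (Suc k) < t) sequentially"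
      using LIMSEQ_Suc[OF assms(2)] that by (rule order_tendstoD)
    then show ?thesis
      by (auto dest: eventually_happens)
  qed
  have 1: "\<exists>\<delta>>0. \<forall>t. 0 < t \<and> t < \<delta> \<longrightarrow> m \<le> K t" for m
  proof (induction m)
    case (Suc m)
    then obtain \<delta> where \<delta>: "\<delta> > 0" "\<And>t. 0 < t \<Longrightarrow> t < \<delta> \<Longrightarrow> m \<le> K t"
      by blast
    have "Suc m \<le> K t" if "0 < t" "t < min \<delta> (r (Suc m))" for t
    proof -
      have "r (Suc (K t)) < t"
        unfolding K_def by (rule LeastI_ex) (use ex that in blast)
      then have "K t \<noteq> m"
        using that by auto
      with \<delta>(2)[of t] that show ?thesis by simp
    qed
    then show ?case
      using \<delta>(1) assms(1) by (intro exI[of _ "min \<delta> (r (Suc m))"]) auto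
  qed (auto intro: exI[of _ 1])
  \<comment> \<open>The shift by \<open>Suc\<close> in the definition makes minimality at
    \<open>K t - 1\<close> speak about \<open>r (K t)\<close>; for \<open>K t = 0\<close> there is
    no smaller index.\<close>
  have 2: "t \<le> r (K t)" if "0 < t" "0 < K t" for t
    using not_less_Least[of "K t - 1" "\<lambda>k. r (Suc k) < t"] that by (simp add: K_def[symmetric])
  show ?thesis
    by (rule that[OF 1 2])
qed

text \<open>The values of \<open>L\<close> near a point need not form a compact set, so an infimum
  need not be attained and a tolerance is required.\<close>

lemma approximate_minimum:
  fixes h :: "'a \<Rightarrow> real"
  assumes "S \<noteq> {}" "\<And>q. q \<in> S \<Longrightarrow> 0 \<le> h q" "e > 0"
  obtains q where "q \<in> S" "\<And>q'. q' \<in> S \<Longrightarrow> h q \<le> h q' + e"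
proof -
  have bdd: "bdd_below (h ` S)"
    using assms(2) by (auto simp: bdd_below_def)
  have "\<exists>y\<in>h ` S. y < Inf (h ` S) + e"
    using cInf_lessD[of "h ` S" "Inf (h ` S) + e"] assms by auto
  then obtain q where "q \<in> S" "h q < Inf (h ` S) + e"
    by blast
  moreover have "Inf (h ` S) \<le> h q'" if "q' \<in> S" for q'
    using that bdd by (simp add: cInf_lower)
  ultimately show ?thesis
    using that[of q] by fastforce
qed

text \<open>At distance \<open>d(x)\<close> from \<open>F\<close> one uses the approximation \<open>g\<^sub>k\<close>, with \<open>k\<close> growing slowly as
  \<open>d(x)\<close> tends to 0. The value of \<open>A x\<close> is not \<open>g\<^sub>k\<close> at the closest point \<open>p\<close> but the value of \<open>L\<close>,
  among those of norm at most \<open>k\<close> taken near \<open>p\<close>, that comes closest to \<open>g\<^sub>k p\<close>; this is what preserves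
  continuity and boundedness of \<open>L\<close>.\<close>
lemma baire_one_field_off_closed:
  fixes F :: "'a::euclidean_space set" and L :: "'a \<Rightarrow> 'b::real_normed_vector"
  assumes "closed F" "F \<noteq> {}" "baire_one_on F L"
  obtains A where
    "\<And>a e. a \<in> F \<Longrightarrow> e > 0 \<Longrightarrow>
      \<exists>\<delta>>0. \<forall>x. x \<notin> F \<and> dist x a < \<delta> \<longrightarrow> norm (A x - L a) * infdist x F \<le> e * dist x a"
    "\<And>a e. a \<in> F \<Longrightarrow> continuous (at a within F) L \<Longrightarrow> e > 0 \<Longrightarrow>
      \<exists>\<delta>>0. \<forall>x. x \<notin> F \<and> dist x a < \<delta> \<longrightarrow> norm (A x - L a) < e"
    "\<And>e. e > 0 \<Longrightarrow> \<exists>\<delta>>0. \<forall>x. x \<notin> F \<and> infdist x F < \<delta> \<longrightarrow>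
      A x = 0 \<or> (\<exists>q\<in>F. dist q x < e \<and> A x = L q)"
    "\<And>x. A x = 0 \<or> A x \<in> L ` F"
proof -
  obtain g where g: "\<And>k. continuous_on F (g k)" "\<And>x. x \<in> F \<Longrightarrow> (\<lambda>k. g k x) \<longlonglongrightarrow> L x"
    using assms(3) unfolding baire_one_on_def by blast
  \<comment> \<open>Exhausting \<open>F\<close> by compact pieces gives each \<open>g k\<close> a
    modulus of uniform continuity; the cap \<open>1 / Suc k\<close> forces the radii to tend to
    0.\<close>
  have "\<exists>\<rho>>0. \<rho> \<le> 1 / Suc k \<and> (\<forall>p\<in>F \<inter> cball 0 k. \<forall>a\<in>F \<inter> cball 0 k.
      dist p a < \<rho> \<longrightarrow> norm (g k p - g k a) \<le> 1 / Suc k)" for k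
  proof -
    have "uniformly_continuous_on (F \<inter> cball 0 (real k)) (g k)"
      using assms(1) g(1)
      by (intro compact_uniformly_continuous closed_Int_compact)
        (auto intro: continuous_on_subset)
    then obtain \<rho> where "\<rho> > 0" "\<And>p a. p \<in> F \<inter> cball 0 k \<Longrightarrow> a \<in> F \<inter> cball 0 k \<Longrightarrow> dist p a < \<rho> \<Longrightarrow>
        dist (g k p) (g k a) < 1 / Suc k"
      unfolding uniformly_continuous_on_def
      by (metis dist_commute of_nat_0_less_iff zero_less_Suc zero_less_divide_1_iff)
    then show ?thesis
      by (intro exI[of _ "min \<rho> (1 / Suc k)"]) (auto simp: dist_norm intro: less_imp_le)
  qed
  then obtain \<rho> where \<rho>: "\<And>k. \<rho> k > 0" "\<And>k. \<rho> k \<le> 1 / Suc k"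
    and g_unif: "\<And>k p a. p \<in> F \<Longrightarrow> a \<in> F \<Longrightarrow> norm p \<le> k \<Longrightarrow> norm a \<le> k \<Longrightarrow>
      dist p a < \<rho> k \<Longrightarrow> norm (g k p - g k a) \<le> 1 / Suc k"
    by (metis IntI mem_cball_0)
  \<comment> \<open>One factor \<open>Suc k\<close> pays for the size of the slopes allowed at level
    \<open>k\<close>; the other remains as the small quantity.\<close>
  define r where "r k = \<rho> k / (Suc k)\<^sup>2" for k
  have "r \<longlonglongrightarrow> 0"
  proof (rule tendsto_sandwich[OF _ _ tendsto_const LIMSEQ_inverse_real_of_nat])
    have "r k \<le> inverse (Suc k)" for k
    proof -
      have "r k \<le> \<rho> k"
        using \<rho>(1)[of k] by (simp add: r_def divide_le_eq one_le_power)
      then show ?thesis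
        using \<rho>(2)[of k] by (simp add: inverse_eq_divide)
    qed
    then show "\<forall>\<^sub>F k in sequentially. r k \<le> inverse (Suc k)" by simp
    show "\<forall>\<^sub>F k in sequentially. 0 \<le> r k"
      using \<rho>(1) by (auto simp: r_def less_imp_le)
  qed
  moreover have "r k > 0" for k
    using \<rho>(1) by (simp add: r_def)
  ultimately obtain K where K: "\<And>m. \<exists>\<delta>>0. \<forall>t. 0 < t \<and> t < \<delta> \<longrightarrow> m \<le> K t"
    and K_le: "\<And>t. 0 < t \<Longrightarrow> 0 < K t \<Longrightarrow> t \<le> r (K t)"
    using slow_index by metis
  define p where "p = closest_point F"
  have p: "p x \<in> F" "dist x (p x) = infdist x F" for x
    using closest_point_in_set[OF assms(1,2)] infdist_eq_setdist[of x F]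
      setdist_closest_point[OF assms(1,2), of x]
    by (auto simp: p_def)
  define k where "k x = K (infdist x F)" for x
  \<comment> \<open>The bound by \<open>k x\<close> limits the slope when the closest point is far
    from \<open>a\<close>; the bound by \<open>\<rho> (k x)\<close> makes the slope depend on
    \<open>L\<close> only near \<open>p x\<close>.\<close>
  define Q where "Q x = {q \<in> F. dist q (p x) < \<rho> (k x) \<and> norm (L q) \<le> k x}" for x
  have "\<exists>q. Q x \<noteq> {} \<longrightarrow> q \<in> Q x \<and>
      (\<forall>q'\<in>Q x. norm (L q - g (k x) (p x)) \<le> norm (L q' - g (k x) (p x)) + 1 / Suc (k x))" for x
  proof (cases "Q x = {}")
    case False
    then show ?thesis
      by (rule approximate_minimum[of _ "\<lambda>q. norm (L q - g (k x) (p x))" "1 / Suc (k x)"]) auto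
  qed simp
  then obtain q where "\<And>x. Q x \<noteq> {} \<longrightarrow> q x \<in> Q x \<and>
      (\<forall>q'\<in>Q x. norm (L (q x) - g (k x) (p x)) \<le> norm (L q' - g (k x) (p x)) + 1 / Suc (k x))"
    using choice[of "\<lambda>x q. Q x \<noteq> {} \<longrightarrow> q \<in> Q x \<and>
      (\<forall>q'\<in>Q x. norm (L q - g (k x) (p x)) \<le> norm (L q' - g (k x) (p x)) + 1 / Suc (k x))"] by blast
  then have q: "\<And>x. Q x \<noteq> {} \<Longrightarrow> q x \<in> Q x"
    and q_min: "\<And>x q'. q' \<in> Q x \<Longrightarrow>
      norm (L (q x) - g (k x) (p x)) \<le> norm (L q' - g (k x) (p x)) + 1 / Suc (k x)"
    by blast+
  \<comment> \<open>Without candidates the slope 0 is used: it respects the bound \<open>k x\<close>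
    and accounts for the alternative \<open>A x = 0\<close> in the conclusions.\<close>
  define A where "A x = (if Q x = {} then 0 else L (q x))" for x
  have pos: "infdist x F > 0" if "x \<notin> F" for x
    using that assms(1,2) in_closed_iff_infdist_zero[of F x] infdist_nonneg[of x F] by force
  have k_ge: "\<exists>\<delta>>0. \<forall>x. x \<notin> F \<and> infdist x F < \<delta> \<longrightarrow> m \<le> k x" for m
    unfolding k_def using K[of m] pos by blast
  have p_dist: "dist (p x) a \<le> 2 * dist x a" if "a \<in> F" for a x
    using dist_triangle[of "p x" a x] p(2)[of x] infdist_le[OF that, of x] by (simp add: dist_commute)
  have NT: "\<exists>\<delta>>0. \<forall>x. x \<notin> F \<and> dist x a < \<delta> \<longrightarrow> norm (A x - L a) * infdist x F \<le> e * dist x a"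
    if a: "a \<in> F" and e: "e > 0" for a e
  proof -
    \<comment> \<open>The closest point is within \<open>2 * dist x a\<close> of \<open>a\<close>,
      so \<open>norm a + 2\<close> puts it inside \<open>cball 0 k\<close>. In the close case the
      slope error is at most \<open>2 * (e / 4) + e / 8\<close>; in the far case
      \<open>4 / Suc k\<close> has to stay below \<open>e\<close>.\<close>
    have "eventually (\<lambda>k. norm (g k a - L a) < e / 8) sequentially"
      using tendstoD[OF g(2)[OF a], of "e / 8"] e by (simp add: dist_norm)
    moreover have "eventually (\<lambda>k. 1 / Suc k < e / 8) sequentially"
      using order_tendstoD(2)[OF LIMSEQ_inverse_real_of_nat, of "e / 8"] e
      by (simp add: inverse_eq_divide)
    moreover have "eventually (\<lambda>k. norm a + 2 \<le> real k) sequentially"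
      "eventually (\<lambda>k. norm (L a) \<le> real k) sequentially"
      using filterlim_real_sequentially by (auto simp: filterlim_at_top)
    ultimately have "eventually (\<lambda>k. norm (g k a - L a) < e / 8 \<and> 1 / Suc k < e / 8 \<and>
        norm a + 2 \<le> real k \<and> norm (L a) \<le> real k) sequentially"
      by eventually_elim blast
    then obtain m where m: "\<And>k. k \<ge> m \<Longrightarrow> norm (g k a - L a) < e / 8 \<and> 1 / Suc k < e / 8 \<and>
        norm a + 2 \<le> real k \<and> norm (L a) \<le> real k"
      by (auto simp: eventually_sequentially)
    obtain \<delta> where \<delta>: "\<delta> > 0" "\<And>x. x \<notin> F \<Longrightarrow> infdist x F < \<delta> \<Longrightarrow> m \<le> k x"
      using k_ge by blast
    have "norm (A x - L a) * infdist x F \<le> e * dist x a" if x: "x \<notin> F" "dist x a < min \<delta> 1" for x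
    proof -
      have d: "infdist x F \<le> dist x a"
        by (rule infdist_le[OF a])
      then have kx: "norm (g (k x) a - L a) < e / 8" "1 / Suc (k x) < e / 8"
        "norm a + 2 \<le> k x" "norm (L a) \<le> k x"
        using m[OF \<delta>(2)[OF x(1)]] x(2) by auto
      show ?thesis
      proof (cases "dist (p x) a < \<rho> (k x)")
        case True
        \<comment> \<open>\<open>a\<close> itself competes in \<open>Q x\<close>, so the chosen
          value is as near to \<open>g (k x) (p x)\<close> as \<open>L a\<close> is, up to
          \<open>1 / Suc (k x)\<close>.\<close>
        then have aQ: "a \<in> Q x"
          using a kx(4) by (simp add: Q_def dist_commute)
        then have Ax: "A x = L (q x)"
          by (auto simp: A_def)
        have "norm (p x) \<le> norm a + dist (p x) a"
          using norm_triangle_ineq2[of "p x" a] by (simp add: dist_norm)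
        also have "dist (p x) a \<le> 2"
          using p_dist[OF a, of x] x(2) by simp
        finally have "norm (g (k x) (p x) - g (k x) a) \<le> 1 / Suc (k x)"
          using kx(3) True by (intro g_unif p(1) a) (auto simp: norm_minus_commute)
        then have "norm (L a - g (k x) (p x)) \<le> e / 4"
          using kx(1,2) norm_triangle_ineq[of "L a - g (k x) a" "g (k x) a - g (k x) (p x)"]
          by (simp add: norm_minus_commute)
        moreover have "norm (A x - L a) \<le> norm (L (q x) - g (k x) (p x)) + norm (L a - g (k x) (p x))"
          using norm_triangle_ineq4[of "L (q x) - g (k x) (p x)" "L a - g (k x) (p x)"]
          by (simp add: Ax)
        ultimately have "norm (A x - L a) \<le> e"
          using q_min[OF aQ] kx(2) e by linarith
        then show ?thesis
          using d infdist_nonneg[of x F] e by (intro mult_mono) auto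
      next
        case False
        \<comment> \<open>Here \<open>x\<close> is at least \<open>\<rho> (k x) / 2\<close> away
          from \<open>a\<close>, whereas \<open>infdist x F\<close> is at most
          \<open>r (k x)\<close>; this beats the crude bound on the slope.\<close>
        have "norm (A x) \<le> k x"
          using q[of x] by (auto simp: A_def Q_def)
        then have A: "norm (A x - L a) \<le> 2 * real (Suc (k x))"
          using norm_triangle_ineq4[of "A x" "L a"] kx(4) by simp
        have "infdist x F \<le> r (k x)"
          using kx(3) norm_ge_zero[of a] unfolding k_def by (intro K_le pos x) linarith
        also have "\<dots> \<le> (2 * dist x a) / (Suc (k x))\<^sup>2"
          unfolding r_def using False p_dist[OF a, of x] by (intro divide_right_mono) auto
        finally have "norm (A x - L a) * infdist x F
            \<le> (2 * real (Suc (k x))) * ((2 * dist x a) / (Suc (k x))\<^sup>2)"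
          using A infdist_nonneg[of x F] by (intro mult_mono) auto
        also have "\<dots> = 4 * (1 / Suc (k x)) * dist x a"
        proof -
          have "(2 * n) * ((2 * t) / n\<^sup>2) = 4 * (1 / n) * t" if "n > 0" for n t :: real
            using that by (simp add: field_simps power2_eq_square)
          then show ?thesis by (simp del: of_nat_Suc)
        qed
        also have "\<dots> \<le> e * dist x a"
          using kx(2) e by (intro mult_right_mono) (auto simp del: of_nat_Suc)
        finally show ?thesis .
      qed
    qed
    then show ?thesis
      using \<delta>(1) by (intro exI[of _ "min \<delta> 1"]) auto
  qed
  have k_inv: "\<exists>\<delta>>0. \<forall>x. x \<notin> F \<and> infdist x F < \<delta> \<longrightarrow> \<rho> (k x) < e \<and> c \<le> real (k x)"
    if "e > 0" for e c
  proof -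
    have "eventually (\<lambda>k. 1 / Suc k < e) sequentially"
      using order_tendstoD(2)[OF LIMSEQ_inverse_real_of_nat, of e] that
      by (simp add: inverse_eq_divide)
    moreover have "eventually (\<lambda>k. c \<le> real k) sequentially"
      using filterlim_real_sequentially by (auto simp: filterlim_at_top)
    ultimately have "eventually (\<lambda>k. 1 / Suc k < e \<and> c \<le> real k) sequentially"
      by eventually_elim blast
    then obtain m where m: "\<And>k. k \<ge> m \<Longrightarrow> 1 / Suc k < e \<and> c \<le> real k"
      by (auto simp: eventually_sequentially)
    then have "\<rho> k < e \<and> c \<le> k" if "k \<ge> m" for k
      using \<rho>(2)[of k] m[OF that] by linarith
    then show ?thesis
      using k_ge[of m] by meson
  qed
  have cont: "\<exists>\<delta>>0. \<forall>x. x \<notin> F \<and> dist x a < \<delta> \<longrightarrow> norm (A x - L a) < e"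
    if a: "a \<in> F" and L: "continuous (at a within F) L" and e: "e > 0" for a e
  proof -
    obtain \<eta> where \<eta>: "\<eta> > 0" "\<And>y. y \<in> F \<Longrightarrow> dist y a < \<eta> \<Longrightarrow> norm (L y - L a) < e"
      using L e unfolding continuous_within_eps_delta dist_norm by meson
    obtain \<delta> where \<delta>: "\<delta> > 0"
      "\<And>x. x \<notin> F \<Longrightarrow> infdist x F < \<delta> \<Longrightarrow> \<rho> (k x) < \<eta> / 2 \<and> norm (L a) + e \<le> k x"
      using k_inv[of "\<eta> / 2" "norm (L a) + e"] \<eta>(1) by auto
    have "norm (A x - L a) < e" if x: "x \<notin> F" "dist x a < min \<delta> (\<eta> / 4)" for x
    proof -
      have kx: "\<rho> (k x) < \<eta> / 2" "norm (L a) + e \<le> k x"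
        using \<delta>(2)[OF x(1)] x(2) infdist_le[OF a, of x] by auto
      have pa: "dist (p x) a < \<eta> / 2"
        using p_dist[OF a, of x] x(2) by simp
      \<comment> \<open>Continuity bounds \<open>L\<close> near \<open>a\<close>, so at high levels
        the closest point passes the norm test and the default 0 does not occur. All members of
        \<open>Q x\<close> are near \<open>a\<close>, where \<open>L\<close> is near
        \<open>L a\<close>.\<close>
      have "norm (L (p x)) \<le> k x"
        using \<eta>(2)[OF p(1), of x] pa \<eta>(1) kx(2) norm_triangle_ineq2[of "L (p x)" "L a"] by simp
      then have "p x \<in> Q x"
        using p(1) \<rho>(1) by (simp add: Q_def)
      then have "q x \<in> Q x" "A x = L (q x)"
        using q by (auto simp: A_def)
      moreover from this have "dist (q x) a < \<eta>"
        using pa kx(1) dist_triangle[of "q x" a "p x"] by (simp add: Q_def)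
      ultimately show ?thesis
        using \<eta>(2) by (simp add: Q_def)
    qed
    then show ?thesis
      using \<delta>(1) \<eta>(1) by (intro exI[of _ "min \<delta> (\<eta> / 4)"]) auto
  qed
  have loc: "\<exists>\<delta>>0. \<forall>x. x \<notin> F \<and> infdist x F < \<delta> \<longrightarrow> A x = 0 \<or> (\<exists>q\<in>F. dist q x < e \<and> A x = L q)"
    if e: "e > 0" for e
  proof -
    obtain \<delta> where \<delta>: "\<delta> > 0" "\<And>x. x \<notin> F \<Longrightarrow> infdist x F < \<delta> \<Longrightarrow> \<rho> (k x) < e / 2"
      using k_inv[of "e / 2" 0] e by auto
    have "A x = 0 \<or> (\<exists>q\<in>F. dist q x < e \<and> A x = L q)"
      if x: "x \<notin> F" "infdist x F < min \<delta> (e / 2)" for x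
    proof (cases "Q x = {}")
      case False
      then have "q x \<in> F" "dist (q x) (p x) < \<rho> (k x)" "A x = L (q x)"
        using q[of x] by (auto simp: A_def Q_def)
      moreover from this have "dist (q x) x < e"
        using \<delta>(2)[OF x(1)] x(2) dist_triangle[of "q x" x "p x"] p(2)[of x]
        by (simp add: dist_commute)
      ultimately show ?thesis by blast
    qed (simp add: A_def)
    then show ?thesis
      using \<delta>(1) e by (intro exI[of _ "min \<delta> (e / 2)"]) auto
  qed
  have range: "A x = 0 \<or> A x \<in> L ` F" for x
    using q[of x] by (auto simp: A_def Q_def)
  show ?thesis
    by (rule that[OF NT cont loc range])
qed

subsection \<open>Pointwise conditions in epsilon-delta form\<close>

lemma not_islimptE:
  fixes a :: "'a::metric_space"
  assumes "\<not> a islimpt A"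
  obtains \<delta> where "\<delta> > 0" "\<And>x. x \<in> A \<Longrightarrow> dist x a < \<delta> \<Longrightarrow> x = a"
  using assms unfolding islimpt_approachable by (meson not_le)

text \<open>Clearing the denominator absorbs the isolated case: there only \<open>x = a\<close>
  remains, where both sides are 0.\<close>

lemma holder_at_iff:
  assumes "0 < \<alpha>"
  shows "holder_at A g a \<alpha> \<longleftrightarrow>
    (\<exists>C\<ge>0. \<exists>\<delta>>0. \<forall>x\<in>A. dist x a < \<delta> \<longrightarrow> norm (g x - g a) \<le> C * dist x a powr \<alpha>)"
proof
  assume "holder_at A g a \<alpha>"
  then consider "\<not> a islimpt A"
    | C where "eventually (\<lambda>x. norm (g x - g a) / norm (x - a) powr \<alpha> \<le> C) (at a within A)"
    unfolding holder_at_def by blast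
  then show "\<exists>C\<ge>0. \<exists>\<delta>>0. \<forall>x\<in>A. dist x a < \<delta> \<longrightarrow> norm (g x - g a) \<le> C * dist x a powr \<alpha>"
  proof cases
    case 1
    then obtain \<delta> where "\<delta> > 0" "\<And>x. x \<in> A \<Longrightarrow> dist x a < \<delta> \<Longrightarrow> x = a"
      by (rule not_islimptE) blast
    then show ?thesis
      by (intro exI[of _ 0] conjI exI[of _ \<delta>]) auto
  next
    case 2
    then obtain \<delta> where \<delta>: "\<delta> > 0" "\<And>x. x \<in> A \<Longrightarrow> x \<noteq> a \<Longrightarrow> dist x a < \<delta> \<Longrightarrow>
        norm (g x - g a) / norm (x - a) powr \<alpha> \<le> C"
      unfolding eventually_at by blast
    have "norm (g x - g a) \<le> max C 0 * dist x a powr \<alpha>" if "x \<in> A" "dist x a < \<delta>" for x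
    proof (cases "x = a")
      case False
      then have "norm (g x - g a) / dist x a powr \<alpha> \<le> max C 0" "dist x a powr \<alpha> > 0"
        using \<delta>(2)[OF that(1) False that(2)] by (auto simp: dist_norm)
      then show ?thesis
        by (simp add: divide_le_eq)
    qed simp
    then show ?thesis
      using \<delta>(1) by (intro exI[of _ "max C 0"] conjI exI[of _ \<delta>]) auto
  qed
next
  assume "\<exists>C\<ge>0. \<exists>\<delta>>0. \<forall>x\<in>A. dist x a < \<delta> \<longrightarrow> norm (g x - g a) \<le> C * dist x a powr \<alpha>"
  then obtain C \<delta> where C: "\<delta> > 0"
    "\<And>x. x \<in> A \<Longrightarrow> dist x a < \<delta> \<Longrightarrow> norm (g x - g a) \<le> C * dist x a powr \<alpha>"
    by blast
  then have "eventually (\<lambda>x. norm (g x - g a) / norm (x - a) powr \<alpha> \<le> C) (at a within A)"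
    unfolding eventually_at
    by (intro exI[of _ \<delta>]) (auto simp: divide_le_eq dist_norm)
  then show "holder_at A g a \<alpha>"
    unfolding holder_at_def by blast
qed

lemma rel_frechet_iff:
  "rel_frechet A g a T \<longleftrightarrow>
    (\<forall>e>0. \<exists>\<delta>>0. \<forall>x\<in>A. dist x a < \<delta> \<longrightarrow> norm (g x - g a - T (x - a)) \<le> e * dist x a)"
proof
  assume rel: "rel_frechet A g a T"
  show "\<forall>e>0. \<exists>\<delta>>0. \<forall>x\<in>A. dist x a < \<delta> \<longrightarrow> norm (g x - g a - T (x - a)) \<le> e * dist x a"
  proof (intro allI impI)
    fix e :: real assume "e > 0"
    show "\<exists>\<delta>>0. \<forall>x\<in>A. dist x a < \<delta> \<longrightarrow> norm (g x - g a - T (x - a)) \<le> e * dist x a"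
    proof (cases "a islimpt A")
      case False
      then obtain \<delta> where \<delta>: "\<delta> > 0" "\<And>x. x \<in> A \<Longrightarrow> dist x a < \<delta> \<Longrightarrow> x = a"
        by (rule not_islimptE) blast
      have "norm (g x - g a - T (x - a)) \<le> e * dist x a"
        if "x \<in> A" "dist x a < \<delta>" for x
        using \<delta>(2)[OF that] by (simp add: blinfun.zero_right)
      then show ?thesis
        using \<delta>(1) by blast
    next
      case True
      then have "((\<lambda>x. norm (g x - g a - T (x - a)) / norm (x - a)) \<longlongrightarrow> 0) (at a within A)"
        using rel unfolding rel_frechet_def by blast
      from tendstoD[OF this \<open>e > 0\<close>] obtain \<delta> where \<delta>: "\<delta> > 0"
        "\<And>x. x \<in> A \<Longrightarrow> x \<noteq> a \<Longrightarrow> dist x a < \<delta> \<Longrightarrow> norm (g x - g a - T (x - a)) / norm (x - a) < e"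
        by (auto simp: eventually_at)
      have "norm (g x - g a - T (x - a)) \<le> e * dist x a" if "x \<in> A" "dist x a < \<delta>" for x
        using \<delta>(2)[of x] that
        by (cases "x = a") (auto simp: divide_less_eq dist_norm blinfun.zero_right)
      then show ?thesis
        using \<delta>(1) by blast
    qed
  qed
next
  assume *: "\<forall>e>0. \<exists>\<delta>>0. \<forall>x\<in>A. dist x a < \<delta> \<longrightarrow> norm (g x - g a - T (x - a)) \<le> e * dist x a"
  have "((\<lambda>x. norm (g x - g a - T (x - a)) / norm (x - a)) \<longlongrightarrow> 0) (at a within A)"
  proof (rule tendstoI)
    fix e :: real assume "e > 0"
    then obtain \<delta> where \<delta>: "\<delta> > 0"
      "\<And>x. x \<in> A \<Longrightarrow> dist x a < \<delta> \<Longrightarrow> norm (g x - g a - T (x - a)) \<le> e / 2 * dist x a"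
      using *[rule_format, of "e / 2"] by auto
    have "norm (g x - g a - T (x - a)) / norm (x - a) < e" if "x \<in> A" "x \<noteq> a" "dist x a < \<delta>" for x
    proof -
      have "norm (g x - g a - T (x - a)) / norm (x - a) \<le> e / 2"
        using \<delta>(2)[OF that(1,3)] that(2) by (simp add: divide_le_eq dist_norm)
      with \<open>e > 0\<close> show ?thesis by linarith
    qed
    then show "\<forall>\<^sub>F x in at a within A. dist (norm (g x - g a - T (x - a)) / norm (x - a)) 0 < e"
      using \<delta>(1) unfolding eventually_at by (intro exI[of _ \<delta>]) auto
  qed
  then show "rel_frechet A g a T"
    unfolding rel_frechet_def by blast
qed

lemma rel_strict_iff:
  "rel_strict A g a T \<longleftrightarrow>
    (\<forall>e>0. \<exists>\<delta>>0. \<forall>x\<in>A. \<forall>y\<in>A. dist x a < \<delta> \<longrightarrow> dist y a < \<delta> \<longrightarrow>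
      norm (g y - g x - T (y - x)) \<le> e * dist y x)"
proof
  assume rel: "rel_strict A g a T"
  show "\<forall>e>0. \<exists>\<delta>>0. \<forall>x\<in>A. \<forall>y\<in>A. dist x a < \<delta> \<longrightarrow> dist y a < \<delta> \<longrightarrow>
      norm (g y - g x - T (y - x)) \<le> e * dist y x"
  proof (intro allI impI)
    fix e :: real assume "e > 0"
    show "\<exists>\<delta>>0. \<forall>x\<in>A. \<forall>y\<in>A. dist x a < \<delta> \<longrightarrow> dist y a < \<delta> \<longrightarrow>
      norm (g y - g x - T (y - x)) \<le> e * dist y x"
    proof (cases "a islimpt A")
      case False
      then obtain \<delta> where \<delta>: "\<delta> > 0" "\<And>x. x \<in> A \<Longrightarrow> dist x a < \<delta> \<Longrightarrow> x = a"
        by (rule not_islimptE) blast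
      have "norm (g y - g x - T (y - x)) \<le> e * dist y x"
        if "x \<in> A" "y \<in> A" "dist x a < \<delta>" "dist y a < \<delta>" for x y
        using \<delta>(2)[OF that(1,3)] \<delta>(2)[OF that(2,4)] by (simp add: blinfun.zero_right)
      then show ?thesis
        using \<delta>(1) by blast
    next
      case True
      then have "((\<lambda>(x, y). norm (g y - g x - T (y - x)) / norm (y - x)) \<longlongrightarrow> 0)
          (at (a, a) within {(x, y). x \<in> A \<and> y \<in> A \<and> x \<noteq> y})"
        using rel unfolding rel_strict_def by blast
      from tendstoD[OF this \<open>e > 0\<close>] obtain \<delta> where \<delta>: "\<delta> > 0"
        "\<And>x y. x \<in> A \<Longrightarrow> y \<in> A \<Longrightarrow> x \<noteq> y \<Longrightarrow> dist (x, y) (a, a) < \<delta> \<Longrightarrow>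
          norm (g y - g x - T (y - x)) / norm (y - x) < e"
        unfolding eventually_at by (auto simp: prod_eq_iff)
      have "norm (g y - g x - T (y - x)) \<le> e * dist y x"
        if "x \<in> A" "y \<in> A" "dist x a < \<delta> / 2" "dist y a < \<delta> / 2" for x y
      proof (cases "x = y")
        case False
        \<comment> \<open>The product distance is at most the sum of the two distances, which is why
          the radius was halved.\<close>
        have "dist (x, y) (a, a) \<le> dist x a + dist y a"
          unfolding dist_Pair_Pair by (rule sqrt_sum_squares_le_sum) auto
        then have "norm (g y - g x - T (y - x)) / norm (y - x) < e"
          using that False by (intro \<delta>(2)) auto
        then show ?thesis
          using False by (simp add: divide_less_eq dist_norm)
      qed (simp add: blinfun.zero_right)
      then show ?thesis
        using \<delta>(1) by (intro exI[of _ "\<delta> / 2"]) auto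
    qed
  qed
next
  assume *: "\<forall>e>0. \<exists>\<delta>>0. \<forall>x\<in>A. \<forall>y\<in>A. dist x a < \<delta> \<longrightarrow> dist y a < \<delta> \<longrightarrow>
      norm (g y - g x - T (y - x)) \<le> e * dist y x"
  have "((\<lambda>(x, y). norm (g y - g x - T (y - x)) / norm (y - x)) \<longlongrightarrow> 0)
      (at (a, a) within {(x, y). x \<in> A \<and> y \<in> A \<and> x \<noteq> y})"
  proof (rule tendstoI)
    fix e :: real assume "e > 0"
    then obtain \<delta> where \<delta>: "\<delta> > 0"
      "\<And>x y. x \<in> A \<Longrightarrow> y \<in> A \<Longrightarrow> dist x a < \<delta> \<Longrightarrow> dist y a < \<delta> \<Longrightarrow>
        norm (g y - g x - T (y - x)) \<le> e / 2 * dist y x"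
      using *[rule_format, of "e / 2"] by auto
    have "norm (g y - g x - T (y - x)) / norm (y - x) < e"
      if "x \<in> A" "y \<in> A" "x \<noteq> y" "dist (x, y) (a, a) < \<delta>" for x y
    proof -
      have "dist x a < \<delta>" "dist y a < \<delta>"
        using that(4) dist_fst_le[of "(x, y)" "(a, a)"] dist_snd_le[of "(x, y)" "(a, a)"] by auto
      then have "norm (g y - g x - T (y - x)) / norm (y - x) \<le> e / 2"
        using \<delta>(2)[OF that(1,2)] that(3) by (simp add: divide_le_eq dist_norm)
      with \<open>e > 0\<close> show ?thesis by linarith
    qed
    then show "\<forall>\<^sub>F z in at (a, a) within {(x, y). x \<in> A \<and> y \<in> A \<and> x \<noteq> y}.
        dist (case z of (x, y) \<Rightarrow> norm (g y - g x - T (y - x)) / norm (y - x)) 0 < e"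
      using \<delta>(1) unfolding eventually_at by (intro exI[of _ \<delta>]) auto
  qed
  then show "rel_strict A g a T"
    unfolding rel_strict_def by blast
qed

lemma rel_strict_imp_rel_frechet:
  assumes "a \<in> A" "rel_strict A g a T"
  shows "rel_frechet A g a T"
  using assms unfolding rel_strict_iff rel_frechet_iff by (metis dist_self)

section \<open>Lipschitz estimates across a closed set\<close>

lemma lipschitz_bound_imp_continuous_within:
  fixes f :: "'a::real_normed_vector \<Rightarrow> 'b::real_normed_vector"
  assumes "open U" "z \<in> U" and lip: "\<And>x. x \<in> U \<Longrightarrow> x \<in> F \<Longrightarrow> norm (f x - f z) \<le> K * norm (x - z)"
  shows "continuous (at z within F) f"
proof -
  have "\<forall>\<^sub>F x in at z within F. x \<in> U \<and> x \<in> F"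
    using assms(1,2) by (auto simp: eventually_at_topological)
  then have "\<forall>\<^sub>F x in at z within F. norm (f x - f z) \<le> K * norm (x - z)"
    by eventually_elim (use lip in blast)
  moreover have "((\<lambda>x. K * norm (x - z)) \<longlongrightarrow> 0) (at z within F)"
    by (auto intro!: tendsto_eq_intros)
  ultimately have "((\<lambda>x. f x - f z) \<longlongrightarrow> 0) (at z within F)"
    by (rule Lim_null_comparison)
  then show ?thesis
    by (simp add: continuous_within LIM_zero_iff)
qed

text \<open>A segment may meet \<open>F\<close> in a Cantor set, and no derivative of
  \<open>g\<close> is given on \<open>F\<close>, so a mean value inequality on each gap would not
  add up. Only the first and the last point of \<open>F\<close> on the segment matter: outside them
  the mean value inequality applies, between them \<open>lip\<close>. Lengths along a segment add,
  so the constant \<open>e\<close> survives.\<close>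

lemma lipschitz_across_closed_set:
  fixes g :: "'a::real_normed_vector \<Rightarrow> 'b::real_normed_vector"
  assumes "closed F" "convex U" and cont: "continuous_on U g"
    and der: "\<And>x. x \<in> U - F \<Longrightarrow> (g has_derivative g' x) (at x)"
    and bound: "\<And>x v. x \<in> U - F \<Longrightarrow> norm (g' x v) \<le> e * norm v"
    and lip: "\<And>x y. x \<in> U \<inter> F \<Longrightarrow> y \<in> U \<inter> F \<Longrightarrow> norm (g y - g x) \<le> e * norm (y - x)"
    and "x \<in> U" "y \<in> U"
  shows "norm (g y - g x) \<le> e * norm (y - x)"
proof -
  define seg where "seg x y t = x + t *\<^sub>R (y - x)" for x y :: 'a and t :: real
  have seg_in: "seg x y t \<in> U" if "x \<in> U" "y \<in> U" "0 \<le> t" "t \<le> 1" for x y t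
  proof -
    have "seg x y t = (1 - t) *\<^sub>R x + t *\<^sub>R y"
      by (simp add: seg_def algebra_simps)
    then show ?thesis
      using convexD[OF \<open>convex U\<close> that(1,2), of "1 - t" t] that by simp
  qed
  have cont_seg: "continuous_on T (seg x y)" for x y T
    unfolding seg_def[abs_def] by (intro continuous_intros)
  \<comment> \<open>The endpoints may lie in \<open>F\<close>: the derivative is needed only in the
    open interval, continuity suffices at the ends.\<close>
  have off: "norm (g y - g x) \<le> e * norm (y - x)"
    if xy: "x \<in> U" "y \<in> U" and notin: "\<And>t. 0 < t \<Longrightarrow> t < 1 \<Longrightarrow> seg x y t \<notin> F" for x y
  proof -
    have "norm (g (seg x y 1) - g (seg x y 0)) \<le> e * norm (y - x) * 1 - e * norm (y - x) * 0"
    proof (rule differentiable_bound_general)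
      show "continuous_on {0..1} (\<lambda>t. g (seg x y t))"
        using seg_in[OF xy] by (intro continuous_on_compose2[OF cont cont_seg]) auto
      fix t :: real assume t: "0 < t" "t < 1"
      have "(seg x y has_derivative (\<lambda>h. h *\<^sub>R (y - x))) (at t)"
        unfolding seg_def[abs_def] by (auto intro!: derivative_eq_intros)
      moreover have g: "(g has_derivative g' (seg x y t)) (at (seg x y t))"
        using seg_in[OF xy, of t] notin t by (intro der) auto
      ultimately have "((\<lambda>t. g (seg x y t)) has_derivative (\<lambda>h. g' (seg x y t) (h *\<^sub>R (y - x)))) (at t)"
        by (rule has_derivative_compose)
      then show "((\<lambda>t. g (seg x y t)) has_vector_derivative g' (seg x y t) (y - x)) (at t)"
        using linear_scale[OF has_derivative_linear[OF g]]
        by (simp add: has_vector_derivative_def)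
      show "((*) (e * norm (y - x)) has_vector_derivative e * norm (y - x)) (at t)"
        by (auto intro!: derivative_eq_intros simp: has_real_derivative_iff_has_vector_derivative[symmetric])
      show "norm (g' (seg x y t) (y - x)) \<le> e * norm (y - x)"
        using seg_in[OF xy, of t] notin t by (intro bound) auto
    qed (auto intro!: continuous_intros)
    then show ?thesis
      by (simp add: seg_def)
  qed
  have to_F: "norm (g y - g x) \<le> e * norm (y - x)" if xy: "x \<in> U" "y \<in> U \<inter> F" for x y
  proof (cases "x \<in> F")
    case False
    let ?T = "{0..1} \<inter> seg x y -` F"
    have "closed (seg x y -` F)"
      by (rule closed_vimage[OF \<open>closed F\<close> cont_seg])
    then have "compact ?T"
      by (intro compact_Int_closed) auto
    moreover have "1 \<in> ?T"
      using xy by (simp add: seg_def)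
    ultimately obtain t where t: "t \<in> ?T" "\<And>s. s \<in> ?T \<Longrightarrow> t \<le> s"
      using compact_attains_inf[of ?T] by blast
    define z where "z = seg x y t"
    have z: "z \<in> U" "z \<in> F"
      using t(1) xy seg_in by (auto simp: z_def)
    have "norm (g z - g x) \<le> e * norm (z - x)"
    proof (rule off[OF xy(1) z(1)])
      fix s :: real assume s: "0 < s" "s < 1"
      have "seg x z s = seg x y (s * t)"
        by (simp add: z_def seg_def)
      moreover have "s * t \<notin> ?T"
      proof
        \<comment> \<open>A hit at \<open>s * t < t\<close> contradicts the choice of
          \<open>t\<close> as first hit, unless \<open>t = 0\<close>; but then \<open>x\<close>
          itself would be in \<open>F\<close>.\<close>
        assume *: "s * t \<in> ?T"
        then have "t \<le> s * t" by (rule t(2))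
        then have "t = 0"
          using s t(1) by (cases "t = 0") auto
        then show False
          using t(1) False by (simp add: seg_def)
      qed
      moreover have "0 \<le> s * t" "s * t \<le> 1"
        using s t(1) by (auto simp: mult_le_one)
      ultimately show "seg x z s \<notin> F"
        by auto
    qed
    moreover have "norm (g y - g z) \<le> e * norm (y - z)"
      using lip z xy by auto
    moreover have "z - x = t *\<^sub>R (y - x)" "y - z = (1 - t) *\<^sub>R (y - x)"
      by (simp_all add: z_def seg_def algebra_simps)
    then have "norm (z - x) = t * norm (y - x)" "norm (y - z) = (1 - t) * norm (y - x)"
      using t(1) by auto
    moreover have "norm (g y - g x) \<le> norm (g y - g z) + norm (g z - g x)"
      using norm_triangle_ineq[of "g y - g z" "g z - g x"] by simp
    ultimately show ?thesis
      by (simp add: algebra_simps)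
  qed (use lip xy in auto)
  show ?thesis
  proof (cases "\<exists>t. 0 < t \<and> t < 1 \<and> seg x y t \<in> F")
    case True
    then obtain t where t: "0 < t" "t < 1" "seg x y t \<in> F" by blast
    \<comment> \<open>Any interior hit will do as a common target: \<open>to_F\<close> is applied
      towards \<open>z\<close> from both ends.\<close>
    define z where "z = seg x y t"
    have z: "z \<in> U \<inter> F"
      using t seg_in[OF assms(7,8), of t] by (simp add: z_def)
    have "norm (g z - g x) \<le> e * norm (z - x)" "norm (g z - g y) \<le> e * norm (z - y)"
      using to_F z assms(7,8) by blast+
    moreover have "z - x = t *\<^sub>R (y - x)" "z - y = (1 - t) *\<^sub>R (x - y)"
      by (simp_all add: z_def seg_def algebra_simps)
    then have "norm (z - x) = t * norm (y - x)" "norm (z - y) = (1 - t) * norm (y - x)"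
      using t by (auto simp: norm_minus_commute)
    moreover have "norm (g y - g x) \<le> norm (g z - g y) + norm (g z - g x)"
      using norm_triangle_ineq4[of "g z - g x" "g z - g y"] by simp
    ultimately show ?thesis
      by (simp add: algebra_simps)
  qed (use off assms(7,8) in blast)
qed

subsection \<open>Gluing affine maps\<close>

text \<open>The slopes \<open>A\<close> are arbitrary here: smoothness off \<open>F\<close> and the
  estimates by active patches rest on the partition alone.\<close>

locale whitney_operator =
  fixes F :: "'a::euclidean_space set" and f :: "'a \<Rightarrow> 'b::real_normed_vector"
    and A :: "'a \<Rightarrow> ('a \<Rightarrow>\<^sub>L 'b)"
  assumes closed: "closed F" and nonempty: "F \<noteq> {}"
begin

definition foot :: "'a \<times> real \<Rightarrow> 'a" where
  "foot i = closest_point F (fst i)"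

text \<open>The slope is read at the centre, which lies off \<open>F\<close> where \<open>A\<close>
  is controlled; the value is read at a point of \<open>F\<close>, where \<open>f\<close> is
  given.\<close>

definition patch :: "'a \<times> real \<Rightarrow> 'a \<Rightarrow> 'b" where
  "patch i y = f (foot i) + A (fst i) (y - foot i)"

definition ext :: "'a \<Rightarrow> 'b" where
  "ext x = (if x \<in> F then f x else (\<Sum>i \<in> whitney_near F x. whitney_fun F i x *\<^sub>R patch i x))"

text \<open>Only these indices carry weight at \<open>x\<close>, and their centres are within a
  third of \<open>infdist x F\<close>; the larger \<open>whitney_near\<close> serves for
  differentiation.\<close>

definition active :: "'a \<Rightarrow> ('a \<times> real) set" where
  "active x = {i \<in> whitney_index F. whitney_fun F i x \<noteq> 0}"

text \<open>Meaningful off \<open>F\<close>, where smoothness makes the derivative bounded linear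
  and \<open>Blinfun\<close> faithful.\<close>

definition D :: "'a \<Rightarrow> ('a \<Rightarrow>\<^sub>L 'b)" where
  "D x = Blinfun (frechet_derivative ext (at x))"

lemma infdist_pos: "x \<notin> F \<Longrightarrow> infdist x F > 0"
  using closed nonempty in_closed_iff_infdist_zero[of F x] infdist_nonneg[of x F] by force

lemma dist_closest_point: "closest_point F x \<in> F" "dist x (closest_point F x) = infdist x F"
  using closest_point_in_set[OF closed nonempty] infdist_eq_setdist[of x F]
    setdist_closest_point[OF closed nonempty, of x] by auto

text \<open>With d = \<open>infdist x F\<close>, the centre is within d/3, so its own distance to
  \<open>F\<close> lies between 2d/3 and 4d/3, and its closest point is within d/3 + 4d/3 <= 2d of
  \<open>x\<close>.\<close>

lemma active_dist:
  assumes "x \<notin> F" "i \<in> active x"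
  shows "fst i \<notin> F" "foot i \<in> F" "dist x (fst i) \<le> infdist x F / 3"
    "infdist x F \<le> 2 * infdist (fst i) F" "infdist (fst i) F \<le> 2 * infdist x F"
    "dist x (foot i) \<le> 2 * infdist x F"
proof -
  note pos = infdist_pos[OF assms(1)]
  show foot: "foot i \<in> F"
    using dist_closest_point by (simp add: foot_def)
  show d: "dist x (fst i) \<le> infdist x F / 3"
    using assms whitney_fun_support[of i F x] by (simp add: active_def)
  then show le: "infdist x F \<le> 2 * infdist (fst i) F" "infdist (fst i) F \<le> 2 * infdist x F"
    using pos infdist_le_add_dist[of x F "fst i"] infdist_le_add_dist[of "fst i" F x]
    by (auto simp: dist_commute)
  then show "fst i \<notin> F"
    using pos by auto
  show "dist x (foot i) \<le> 2 * infdist x F"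
    using d pos infdist_le_add_dist[of "fst i" F x] dist_closest_point[of "fst i"]
      dist_triangle[of x "foot i" "fst i"]
    by (simp add: foot_def dist_commute)
qed

lemma active_near:
  assumes "dist x y < infdist x F / 4"
  shows "active y \<subseteq> whitney_near F x"
  using whitney_bump_support_near assms by (auto simp: active_def whitney_fun_def)

text \<open>\<open>whitney_near F x\<close> and \<open>whitney_near F y\<close> both contain
  \<open>active y\<close>, and the other terms vanish at \<open>y\<close>; so the index set may be
  frozen around \<open>x\<close>.\<close>

lemma ext_local:
  assumes "dist x y < infdist x F / 4"
  shows "ext y = (\<Sum>i \<in> whitney_near F x. whitney_fun F i y *\<^sub>R patch i y)"
proof -
  have pos: "infdist x F > 0" "infdist y F > 0"
    using assms zero_le_dist[of x y] infdist_pos_of_dist_less by (linarith, blast)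
  then have "y \<notin> F" by auto
  have "(\<Sum>i \<in> whitney_near F z. whitney_fun F i y *\<^sub>R patch i y)
      = (\<Sum>i \<in> active y. whitney_fun F i y *\<^sub>R patch i y)" if "dist z y < infdist z F / 4" for z
    using whitney_near_finite[of z F] active_near[OF that] that zero_le_dist[of z y]
    by (intro sum.mono_neutral_right) (auto simp: active_def whitney_near_def)
  from this[OF assms] this[of y] show ?thesis
    using pos \<open>y \<notin> F\<close> by (simp add: ext_def)
qed

lemma smooth_ext: "higher_differentiable_on (- F) ext n"
proof (rule higher_differentiable_on_local)
  show "open (- F)" using closed by auto
  fix x assume "x \<in> - F"
  then have d: "infdist x F > 0" using infdist_pos by simp
  let ?U = "ball x (infdist x F / 4)"
  have sub: "?U \<subseteq> - F"
    using infdist_pos_of_dist_less[of x _ F] by fastforce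
  have "higher_differentiable_on ?U (\<lambda>y. \<Sum>i \<in> whitney_near F x. whitney_fun F i y *\<^sub>R patch i y) n"
    unfolding patch_def
    by (intro higher_differentiable_on_sum higher_differentiable_on_scaleR higher_differentiable_on_add
        higher_differentiable_on_const higher_differentiable_on_blinfun open_ball whitney_near_finite d
        higher_differentiable_on_subset[OF higher_differentiable_on_whitney_fun[OF closed nonempty] sub])
  then have "higher_differentiable_on ?U ext n"
    by (rule higher_differentiable_on_cong[OF open_ball, rotated]) (simp add: ext_local)
  then show "\<exists>U. open U \<and> x \<in> U \<and> higher_differentiable_on U ext n"
    using d by (intro exI[of _ ?U]) auto
qed

lemma D_eq:
  assumes "x \<notin> F"
  shows "(ext has_derivative D x) (at x)" "blinfun_apply (D x) = frechet_derivative ext (at x)"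
proof -
  have d: "(ext has_derivative frechet_derivative ext (at x)) (at x)"
    by (rule higher_differentiable_on_has_derivative[OF smooth_ext]) (use assms in simp)
  then show "blinfun_apply (D x) = frechet_derivative ext (at x)"
    unfolding D_def by (intro bounded_linear_Blinfun_apply has_derivative_bounded_linear)
  with d show "(ext has_derivative D x) (at x)" by simp
qed

text \<open>Off \<open>F\<close> the value is a convex combination of active patches, and balls are
  convex.\<close>

lemma ext_estimate:
  assumes "x \<notin> F" "\<And>i. i \<in> active x \<Longrightarrow> norm (patch i x - c) \<le> M"
  shows "norm (ext x - c) \<le> M"
proof -
  let ?J = "whitney_near F x"
  have d: "dist x x < infdist x F / 4"
    using infdist_pos[OF assms(1)] by simp
  have "ext x - c = (\<Sum>i\<in>?J. whitney_fun F i x *\<^sub>R patch i x) - (\<Sum>i\<in>?J. whitney_fun F i x) *\<^sub>R c"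
    by (simp add: ext_local[OF d] sum_whitney_fun[OF d])
  also have "\<dots> = (\<Sum>i\<in>?J. whitney_fun F i x *\<^sub>R (patch i x - c))"
    by (simp add: scaleR_sum_left scaleR_diff_right sum_subtractf)
  also have "norm \<dots> \<le> (\<Sum>i\<in>?J. whitney_fun F i x * M)"
  proof (intro sum_norm_le)
    fix i assume "i \<in> ?J"
    then show "norm (whitney_fun F i x *\<^sub>R (patch i x - c)) \<le> whitney_fun F i x * M"
      using assms(2)[of i] whitney_fun_nonneg[of F i x]
      by (cases "whitney_fun F i x = 0") (auto simp: active_def whitney_near_def intro: mult_left_mono)
  qed
  also have "\<dots> = M"
    by (simp add: sum_whitney_fun[OF d] flip: sum_distrib_right)
  finally show ?thesis .
qed

text \<open>The derivatives of the partition functions sum to 0, so the constant \<open>c\<close> may be subtracted from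
  each patch before estimating.\<close>
lemma D_estimate:
  obtains C where "C \<ge> 0" "\<And>x c T M m. x \<notin> F \<Longrightarrow> (\<And>i. i \<in> active x \<Longrightarrow> norm (patch i x - c) \<le> M) \<Longrightarrow>
    (\<And>i. i \<in> active x \<Longrightarrow> norm (A (fst i) - T) \<le> m) \<Longrightarrow> norm (D x - T) \<le> m + C * M / infdist x F"
proof -
  obtain C where "C \<ge> 0" and C: "\<And>x. infdist x F > 0 \<Longrightarrow> \<exists>E.
      (\<forall>i \<in> whitney_near F x. (whitney_fun F i has_derivative E i) (at x)) \<and>
      (\<forall>v. (\<Sum>i \<in> whitney_near F x. \<bar>E i v\<bar>) \<le> C / infdist x F * norm v)"
    using whitney_fun_derivative_bound[of F] by blast
  have "norm (D x - T) \<le> m + C * M / infdist x F"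
    if x: "x \<notin> F" and M: "\<And>i. i \<in> active x \<Longrightarrow> norm (patch i x - c) \<le> M"
      and m: "\<And>i. i \<in> active x \<Longrightarrow> norm (A (fst i) - T) \<le> m" for x c T M m
  proof -
    let ?J = "whitney_near F x"
    let ?d = "infdist x F"
    have pos: "?d > 0" by (rule infdist_pos[OF x])
    then have d: "dist x x < ?d / 4" by simp
    obtain E where E: "\<And>i. i \<in> ?J \<Longrightarrow> (whitney_fun F i has_derivative E i) (at x)"
      "\<And>v. (\<Sum>i \<in> ?J. \<bar>E i v\<bar>) \<le> C / ?d * norm v"
      using C[OF pos] by blast
    have act: "i \<in> active x \<longleftrightarrow> whitney_fun F i x \<noteq> 0" if "i \<in> ?J" for i
      using that by (auto simp: active_def whitney_near_def)
    \<comment> \<open>A nonnegative function vanishing at \<open>x\<close> has a minimum there, so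
      its derivative is 0. Hence hypotheses on active indices suffice although the sums run over
      near ones.\<close>
    have E0: "E i v = 0" if "i \<in> ?J" "i \<notin> active x" for i v
    proof -
      have "E i = (\<lambda>v. 0)"
        by (rule differential_zero_maxmin[of x UNIV "whitney_fun F i"])
          (use that act[OF that(1)] E(1)[OF that(1)] whitney_fun_nonneg[of F i] in simp_all)
      then show ?thesis by simp
    qed
    have "((\<lambda>y. \<Sum>i\<in>?J. whitney_fun F i y) has_derivative (\<lambda>v. \<Sum>i\<in>?J. E i v)) (at x)"
      by (intro has_derivative_sum E(1))
    then have "((\<lambda>y. 1) has_derivative (\<lambda>v. \<Sum>i\<in>?J. E i v)) (at x)"
      by (rule has_derivative_transform_within_open[where s = "ball x (?d / 4)"])
        (use pos sum_whitney_fun[of x _ F] in auto)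
    then have sumE: "(\<Sum>i\<in>?J. E i v) = 0" for v
      using has_derivative_unique[OF has_derivative_const] by metis
    have "(patch i has_derivative A (fst i)) (at x)" for i
      unfolding patch_def[abs_def] by (auto intro!: derivative_eq_intros)
    then have "((\<lambda>y. \<Sum>i\<in>?J. whitney_fun F i y *\<^sub>R patch i y) has_derivative
        (\<lambda>v. \<Sum>i\<in>?J. whitney_fun F i x *\<^sub>R A (fst i) v + E i v *\<^sub>R patch i x)) (at x)"
      by (intro has_derivative_sum has_derivative_scaleR E(1))
    then have dext: "(ext has_derivative
        (\<lambda>v. \<Sum>i\<in>?J. whitney_fun F i x *\<^sub>R A (fst i) v + E i v *\<^sub>R patch i x)) (at x)"
      by (rule has_derivative_transform_within_open[where s = "ball x (?d / 4)"])
        (use pos in \<open>auto simp: ext_local\<close>)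
    have Dv: "D x v = (\<Sum>i\<in>?J. whitney_fun F i x *\<^sub>R A (fst i) v + E i v *\<^sub>R patch i x)" for v
      by (rule fun_cong[OF has_derivative_unique[OF D_eq(1)[OF x] dext]])
    have bound: "norm (D x v - T v) \<le> (m + C * M / ?d) * norm v" for v
    proof -
      have rearrange: "a + b - c - d = (a - c) + (b - d)" for a b c d :: 'b
        by simp
      \<comment> \<open>The weights sum to 1 and their derivatives to 0, so \<open>T\<close> can be
        distributed over the first group of terms and \<open>c\<close> over the second.\<close>
      have "D x v - T v = D x v - (\<Sum>i\<in>?J. whitney_fun F i x) *\<^sub>R T v - (\<Sum>i\<in>?J. E i v) *\<^sub>R c"
        by (simp add: sum_whitney_fun[OF d] sumE)
      also have "\<dots> = (\<Sum>i\<in>?J. whitney_fun F i x *\<^sub>R (A (fst i) - T) v + E i v *\<^sub>R (patch i x - c))"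
        by (simp only: Dv scaleR_sum_left scaleR_diff_right blinfun.diff_left sum_subtractf sum.distrib
            rearrange)
      also have "norm \<dots> \<le> (\<Sum>i\<in>?J. whitney_fun F i x * (m * norm v) + \<bar>E i v\<bar> * M)"
      proof (intro sum_norm_le)
        fix i assume i: "i \<in> ?J"
        show "norm (whitney_fun F i x *\<^sub>R (A (fst i) - T) v + E i v *\<^sub>R (patch i x - c))
            \<le> whitney_fun F i x * (m * norm v) + \<bar>E i v\<bar> * M"
        proof (cases "i \<in> active x")
          case True
          have "norm ((A (fst i) - T) v) \<le> m * norm v"
            using norm_blinfun[of "A (fst i) - T" v] m[OF True]
            by (meson mult_right_mono norm_ge_zero order_trans)
          then have "norm (whitney_fun F i x *\<^sub>R (A (fst i) - T) v) \<le> whitney_fun F i x * (m * norm v)"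
            using whitney_fun_nonneg[of F i x] by (simp add: mult_left_mono)
          moreover have "norm (E i v *\<^sub>R (patch i x - c)) \<le> \<bar>E i v\<bar> * M"
            using M[OF True] by (simp add: mult_left_mono)
          ultimately show ?thesis
            using norm_triangle_mono by blast
        qed (use E0 act i in simp)
      qed
      also have "\<dots> = m * norm v + (\<Sum>i\<in>?J. \<bar>E i v\<bar>) * M"
        by (simp add: sum.distrib sum_whitney_fun[OF d] flip: sum_distrib_right)
      also have "\<dots> \<le> m * norm v + (C / ?d * norm v) * M"
      proof -
        have "norm (ext x - c) \<le> M"
          by (rule ext_estimate[OF x M])
        then have "M \<ge> 0"
          using norm_ge_zero order_trans by blast
        then show ?thesis
          using E(2) by (intro add_left_mono mult_right_mono)
      qed
      finally show ?thesis
        by (simp add: algebra_simps)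
    qed
    \<comment> \<open>An active index exists because the weights sum to 1; it supplies
      \<open>0 \<le> m\<close> for the operator norm bound.\<close>
    have "active x \<noteq> {}"
    proof
      assume "active x = {}"
      then have "(\<Sum>i\<in>?J. whitney_fun F i x) = 0"
        using act by (intro sum.neutral) auto
      then show False
        by (simp add: sum_whitney_fun[OF d])
    qed
    then obtain i where "i \<in> active x" by blast
    then have "0 \<le> m" "0 \<le> M"
      using m[of i] M[of i] norm_ge_zero order_trans by blast+
    then show ?thesis
      using bound pos \<open>C \<ge> 0\<close> by (intro norm_blinfun_bound) (auto simp: blinfun.diff_left)
  qed
  with \<open>C \<ge> 0\<close> show ?thesis by (rule that)
qed

end

subsection \<open>Properties of the extension\<close>

text \<open>These conditions are the output of \<open>baire_one_field_off_closed\<close>; the Baire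
  property acts from here on only through them.\<close>

locale whitney_baire_one = whitney_operator +
  fixes L :: "'a::euclidean_space \<Rightarrow> ('a \<Rightarrow>\<^sub>L 'b::real_normed_vector)"
  assumes nontangential: "\<And>a e. a \<in> F \<Longrightarrow> e > 0 \<Longrightarrow>
      \<exists>\<delta>>0. \<forall>x. x \<notin> F \<and> dist x a < \<delta> \<longrightarrow> norm (A x - L a) * infdist x F \<le> e * dist x a"
    and preserves_continuity: "\<And>a e. a \<in> F \<Longrightarrow> continuous (at a within F) L \<Longrightarrow> e > 0 \<Longrightarrow>
      \<exists>\<delta>>0. \<forall>x. x \<notin> F \<and> dist x a < \<delta> \<longrightarrow> norm (A x - L a) < e"
    and local_values: "\<And>e. e > 0 \<Longrightarrow> \<exists>\<delta>>0. \<forall>x. x \<notin> F \<and> infdist x F < \<delta> \<longrightarrow>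
      A x = 0 \<or> (\<exists>q\<in>F. dist q x < e \<and> A x = L q)"
    and field_values: "\<And>x. A x = 0 \<or> A x \<in> L ` F"
begin

lemma active_dist_point:
  assumes "x \<notin> F" "i \<in> active x" "a \<in> F"
  shows "dist (fst i) a \<le> 2 * dist x a" "dist (foot i) a \<le> 3 * dist x a"
    "norm (x - foot i) \<le> 2 * infdist x F" "infdist x F \<le> dist x a"
proof -
  note d = active_dist[OF assms(1,2)]
  show le: "infdist x F \<le> dist x a"
    by (rule infdist_le[OF assms(3)])
  show "norm (x - foot i) \<le> 2 * infdist x F"
    using d by (simp add: dist_norm)
  show "dist (fst i) a \<le> 2 * dist x a" "dist (foot i) a \<le> 3 * dist x a"
    using d(3,6) le dist_triangle[of "fst i" a x] dist_triangle[of "foot i" a x] infdist_nonneg[of x F]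
    by (auto simp: dist_commute)
qed

section \<open>Pointwise properties at points of \<open>F\<close>\<close>

text \<open>The slope error acts on \<open>x - foot i\<close>, of length at most
  \<open>4 * infdist (fst i) F\<close>, so \<open>nontangential\<close> applies at the centre, which
  is within \<open>2 * dist x a\<close> of \<open>a\<close>. The factors 4 and 2 explain
  \<open>e / 8\<close>, and the latter also \<open>\<delta> / 2\<close>.\<close>

lemma patch_near:
  assumes a: "a \<in> F" and e: "e > 0"
  obtains \<delta> where "\<delta> > 0" "\<And>x i. x \<notin> F \<Longrightarrow> dist x a < \<delta> \<Longrightarrow> i \<in> active x \<Longrightarrow>
    norm (patch i x - f (foot i) - L a (x - foot i)) \<le> e * dist x a"
proof -
  obtain \<delta> where \<delta>: "\<delta> > 0"
    "\<And>x. x \<notin> F \<Longrightarrow> dist x a < \<delta> \<Longrightarrow> norm (A x - L a) * infdist x F \<le> e / 8 * dist x a"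
    using nontangential[OF a, of "e / 8"] e by auto
  have "norm (patch i x - f (foot i) - L a (x - foot i)) \<le> e * dist x a"
    if x: "x \<notin> F" "dist x a < \<delta> / 2" and i: "i \<in> active x" for x i
  proof -
    note d = active_dist[OF x(1) i] active_dist_point[OF x(1) i a]
    have "norm (patch i x - f (foot i) - L a (x - foot i)) = norm ((A (fst i) - L a) (x - foot i))"
      by (simp add: patch_def blinfun.diff_left)
    also have "\<dots> \<le> norm (A (fst i) - L a) * norm (x - foot i)"
      by (rule norm_blinfun)
    also have "\<dots> \<le> norm (A (fst i) - L a) * (4 * infdist (fst i) F)"
      using d by (intro mult_left_mono) auto
    also have "\<dots> = 4 * (norm (A (fst i) - L a) * infdist (fst i) F)"
      by simp
    also have "\<dots> \<le> 4 * (e / 8 * dist (fst i) a)"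
      using d x(2) by (intro mult_left_mono \<delta>(2)) auto
    also have "\<dots> \<le> 4 * (e / 8 * (2 * dist x a))"
      using d e by (intro mult_left_mono) auto
    finally show ?thesis by simp
  qed
  then show ?thesis
    using \<delta>(1) by (intro that[of "\<delta> / 2"]) auto
qed

lemma patch_near_value:
  assumes a: "a \<in> F"
  obtains \<delta> where "\<delta> > 0" "\<And>x i. x \<notin> F \<Longrightarrow> dist x a < \<delta> \<Longrightarrow> i \<in> active x \<Longrightarrow>
    norm (patch i x - f (foot i)) \<le> (2 * norm (L a) + 1) * dist x a"
proof -
  obtain \<delta> where \<delta>: "\<delta> > 0" "\<And>x i. x \<notin> F \<Longrightarrow> dist x a < \<delta> \<Longrightarrow> i \<in> active x \<Longrightarrow>
    norm (patch i x - f (foot i) - L a (x - foot i)) \<le> 1 * dist x a"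
    by (rule patch_near[OF a zero_less_one]) blast
  have "norm (patch i x - f (foot i)) \<le> (2 * norm (L a) + 1) * dist x a"
    if x: "x \<notin> F" "dist x a < \<delta>" and i: "i \<in> active x" for x i
  proof -
    have "norm (L a (x - foot i)) \<le> norm (L a) * norm (x - foot i)"
      by (rule norm_blinfun)
    also have "\<dots> \<le> norm (L a) * (2 * dist x a)"
      using active_dist_point[OF x(1) i a] by (intro mult_left_mono) auto
    finally have "norm (L a (x - foot i)) \<le> 2 * norm (L a) * dist x a"
      by simp
    then show ?thesis
      using \<delta>(2)[OF x i] norm_triangle_ineq[of "patch i x - f (foot i) - L a (x - foot i)" "L a (x - foot i)"]
      by (simp add: distrib_right)
  qed
  with \<delta>(1) show ?thesis by (rule that)
qed

lemma ext_continuous: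
  assumes a: "a \<in> F" and cont: "continuous (at a within F) f"
  shows "continuous (at a) ext"
  unfolding continuous_at_eps_delta
proof (intro allI impI)
  fix e :: real assume "e > 0"
  obtain \<delta>1 where \<delta>1: "\<delta>1 > 0" "\<And>y. y \<in> F \<Longrightarrow> dist y a < \<delta>1 \<Longrightarrow> dist (f y) (f a) < e / 2"
    using cont \<open>e > 0\<close> unfolding continuous_within_eps_delta by (meson half_gt_zero)
  obtain \<delta>2 where \<delta>2: "\<delta>2 > 0" "\<And>x i. x \<notin> F \<Longrightarrow> dist x a < \<delta>2 \<Longrightarrow> i \<in> active x \<Longrightarrow>
    norm (patch i x - f (foot i)) \<le> (2 * norm (L a) + 1) * dist x a"
    by (rule patch_near_value[OF a]) blast
  define c where "c = 2 * norm (L a) + 1"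
  have c: "c > 0" using norm_ge_zero[of "L a"] by (simp add: c_def add_nonneg_pos)
  \<comment> \<open>A foot point can be three times as far from \<open>a\<close> as
    \<open>x\<close>, hence \<open>\<delta>1 / 3\<close>; the last bound keeps the affine part below
    \<open>e / 4\<close>.\<close>
  define \<delta> where "\<delta> = min (\<delta>1 / 3) (min \<delta>2 (e / (4 * c)))"
  have "\<delta> > 0"
    using \<delta>1 \<delta>2 c \<open>e > 0\<close> by (simp add: \<delta>_def)
  moreover have "dist (ext x) (ext a) < e" if x: "dist x a < \<delta>" for x
  proof (cases "x \<in> F")
    case True
    then show ?thesis
      using \<delta>1(1) \<delta>1(2)[OF True] x a \<open>e > 0\<close> by (simp add: ext_def \<delta>_def)
  next
    case False
    have "norm (ext x - f a) \<le> 3 * e / 4"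
    proof (rule ext_estimate[OF False])
      fix i assume i: "i \<in> active x"
      have "norm (patch i x - f (foot i)) \<le> c * dist x a"
        unfolding c_def using x by (intro \<delta>2 False i) (simp add: \<delta>_def)
      also have "\<dots> \<le> c * (e / (4 * c))"
        using x c by (intro mult_left_mono) (auto simp: \<delta>_def)
      finally have "norm (patch i x - f (foot i)) \<le> e / 4"
        using c by simp
      moreover have "dist (f (foot i)) (f a) < e / 2"
        using active_dist_point(2)[OF False i a] x
        by (intro \<delta>1 active_dist(2)[OF False i]) (simp add: \<delta>_def)
      ultimately show "norm (patch i x - f a) \<le> 3 * e / 4"
        using norm_triangle_ineq[of "patch i x - f (foot i)" "f (foot i) - f a"] by (simp add: dist_norm)
    qed
    then show ?thesis
      using a \<open>e > 0\<close> by (simp add: ext_def dist_norm)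
  qed
  ultimately show "\<exists>\<delta>>0. \<forall>x. dist x a < \<delta> \<longrightarrow> dist (ext x) (ext a) < e"
    by blast
qed

lemma ext_holder:
  assumes a: "a \<in> F" and \<alpha>: "0 < \<alpha>" "\<alpha> \<le> 1" and holder: "holder_at F f a \<alpha>"
  shows "holder_at UNIV ext a \<alpha>"
proof -
  obtain C \<delta>1 where C: "C \<ge> 0" "\<delta>1 > 0"
    "\<And>y. y \<in> F \<Longrightarrow> dist y a < \<delta>1 \<Longrightarrow> norm (f y - f a) \<le> C * dist y a powr \<alpha>"
    using holder unfolding holder_at_iff[OF \<alpha>(1)] by blast
  obtain \<delta>2 where \<delta>2: "\<delta>2 > 0" "\<And>x i. x \<notin> F \<Longrightarrow> dist x a < \<delta>2 \<Longrightarrow> i \<in> active x \<Longrightarrow>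
    norm (patch i x - f (foot i)) \<le> (2 * norm (L a) + 1) * dist x a"
    by (rule patch_near_value[OF a]) blast
  define c where "c = 2 * norm (L a) + 1"
  have c: "c > 0" using norm_ge_zero[of "L a"] by (simp add: c_def add_nonneg_pos)
  \<comment> \<open>Radius 1 gives \<open>dist x a <= dist x a powr \<alpha>\<close>, as \<alpha>
    \<le> 1; this absorbs the linear error of the patches.\<close>
  define \<delta> where "\<delta> = min (\<delta>1 / 3) (min \<delta>2 1)"
  have "\<delta> > 0" using C \<delta>2 by (simp add: \<delta>_def)
  moreover have "norm (ext x - ext a) \<le> (C * 3 + c) * dist x a powr \<alpha>" if x: "dist x a < \<delta>" for x
  proof (cases "x \<in> F")
    case True
    have "norm (f x - f a) \<le> C * dist x a powr \<alpha>"
      using x C(2) by (intro C True) (simp add: \<delta>_def)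
    also have "\<dots> \<le> (C * 3 + c) * dist x a powr \<alpha>"
      using C c by (intro mult_right_mono) auto
    finally show ?thesis
      using True a by (simp add: ext_def)
  next
    case False
    have "norm (ext x - f a) \<le> (C * 3 + c) * dist x a powr \<alpha>"
    proof (rule ext_estimate[OF False])
      fix i assume i: "i \<in> active x"
      have "norm (patch i x - f (foot i)) \<le> c * dist x a"
        unfolding c_def using x by (intro \<delta>2 False i) (simp add: \<delta>_def)
      also have "dist x a \<le> dist x a powr \<alpha>"
        using powr_mono'[of \<alpha> 1 "dist x a"] \<alpha> x by (simp add: \<delta>_def)
      finally have 1: "norm (patch i x - f (foot i)) \<le> c * dist x a powr \<alpha>"
        using c by simp
      have "norm (f (foot i) - f a) \<le> C * dist (foot i) a powr \<alpha>"
        using active_dist_point(2)[OF False i a] x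
        by (intro C active_dist(2)[OF False i]) (simp add: \<delta>_def)
      also have "dist (foot i) a powr \<alpha> \<le> (3 * dist x a) powr \<alpha>"
        using active_dist_point(2)[OF False i a] \<alpha> by (intro powr_mono2) auto
      also have "\<dots> = 3 powr \<alpha> * dist x a powr \<alpha>"
        by (simp add: powr_mult)
      also have "3 powr \<alpha> \<le> (3 :: real)"
        using powr_mono[of \<alpha> 1 "3 :: real"] \<alpha> by simp
      finally have "norm (f (foot i) - f a) \<le> C * (3 * dist x a powr \<alpha>)"
        using C(1) by (simp add: mult_left_mono mult_right_mono)
      with 1 show "norm (patch i x - f a) \<le> (C * 3 + c) * dist x a powr \<alpha>"
        using norm_triangle_ineq[of "patch i x - f (foot i)" "f (foot i) - f a"] by (simp add: distrib_right)
    qed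
    then show ?thesis
      using a by (simp add: ext_def)
  qed
  ultimately show ?thesis
    unfolding holder_at_iff[OF \<alpha>(1)] using C(1) c
    by (intro exI[of _ "C * 3 + c"] conjI exI[of _ \<delta>]) auto
qed

lemma ext_frechet:
  assumes a: "a \<in> F" and rel: "rel_frechet F f a (L a)"
  shows "rel_frechet UNIV ext a (L a)"
  unfolding rel_frechet_iff
proof (intro allI impI)
  fix e :: real assume "e > 0"
  obtain \<delta>1 where \<delta>1: "\<delta>1 > 0"
    "\<And>y. y \<in> F \<Longrightarrow> dist y a < \<delta>1 \<Longrightarrow> norm (f y - f a - L a (y - a)) \<le> e / 6 * dist y a"
    using rel[unfolded rel_frechet_iff, rule_format, of "e / 6"] \<open>e > 0\<close> by auto
  obtain \<delta>2 where \<delta>2: "\<delta>2 > 0" "\<And>x i. x \<notin> F \<Longrightarrow> dist x a < \<delta>2 \<Longrightarrow> i \<in> active x \<Longrightarrow>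
    norm (patch i x - f (foot i) - L a (x - foot i)) \<le> e / 2 * dist x a"
    by (rule patch_near[OF a half_gt_zero[OF \<open>e > 0\<close>]]) blast
  define \<delta> where "\<delta> = min (\<delta>1 / 3) \<delta>2"
  have "\<delta> > 0" using \<delta>1 \<delta>2 by (simp add: \<delta>_def)
  moreover have "norm (ext x - ext a - L a (x - a)) \<le> e * dist x a" if x: "dist x a < \<delta>" for x
  proof (cases "x \<in> F")
    case True
    have "norm (f x - f a - L a (x - a)) \<le> e / 6 * dist x a"
      using x \<delta>1(1) by (intro \<delta>1 True) (simp add: \<delta>_def)
    also have "\<dots> \<le> e * dist x a"
      using \<open>e > 0\<close> by (intro mult_right_mono) auto
    finally show ?thesis
      using True a by (simp add: ext_def)
  next
    case False
    have "norm (ext x - (f a + L a (x - a))) \<le> e * dist x a"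
    proof (rule ext_estimate[OF False])
      fix i assume i: "i \<in> active x"
      have 1: "norm (patch i x - f (foot i) - L a (x - foot i)) \<le> e / 2 * dist x a"
        using x by (intro \<delta>2 False i) (simp add: \<delta>_def)
      have "norm (f (foot i) - f a - L a (foot i - a)) \<le> e / 6 * dist (foot i) a"
        using active_dist_point(2)[OF False i a] x
        by (intro \<delta>1 active_dist(2)[OF False i]) (simp add: \<delta>_def)
      also have "\<dots> \<le> e / 6 * (3 * dist x a)"
        using active_dist_point(2)[OF False i a] \<open>e > 0\<close> by (intro mult_left_mono) auto
      finally have 2: "norm (f (foot i) - f a - L a (foot i - a)) \<le> e / 2 * dist x a"
        by simp
      \<comment> \<open>Passing through the foot point separates the slope error of the patch from
        the error of \<open>f\<close> at a point of \<open>F\<close>; the factor 3 for feet has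
        turned \<open>e / 6\<close> into \<open>e / 2\<close>.\<close>
      have eq: "patch i x - (f a + L a (x - a))
          = (patch i x - f (foot i) - L a (x - foot i)) + (f (foot i) - f a - L a (foot i - a))"
        by (simp add: blinfun.diff_right)
      show "norm (patch i x - (f a + L a (x - a))) \<le> e * dist x a"
        unfolding eq using norm_triangle_mono[OF 1 2] by simp
    qed
    then show ?thesis
      using a by (simp add: ext_def diff_diff_add)
  qed
  ultimately show "\<exists>\<delta>>0. \<forall>x\<in>UNIV. dist x a < \<delta> \<longrightarrow> norm (ext x - ext a - L a (x - a)) \<le> e * dist x a"
    by blast
qed

lemma ext_has_derivative:
  assumes a: "a \<in> F" and rel: "rel_frechet F f a (L a)"
  shows "(ext has_derivative L a) (at a)"
proof -
  have "((\<lambda>x. norm (ext x - ext a - L a (x - a)) / norm (x - a)) \<longlongrightarrow> 0) (at a)"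
    using ext_frechet[OF assms] islimpt_UNIV[of a] unfolding rel_frechet_def by blast
  then show ?thesis
    by (simp add: has_derivative_iff_norm blinfun.bounded_linear_right)
qed

text \<open>The comparison affine map is taken at the closest point of \<open>F\<close> to \<open>x\<close>, because \<open>infdist x F\<close> may be much
  smaller than \<open>dist x a\<close>.\<close>
lemma D_near:
  assumes a: "a \<in> F" and cont: "continuous (at a within F) L" and strict: "rel_strict F f a (L a)"
    and "e > 0"
  shows "\<exists>\<delta>>0. \<forall>x. x \<notin> F \<and> dist x a < \<delta> \<longrightarrow> norm (D x - L a) \<le> e"
proof -
  obtain C where C: "C \<ge> 0" "\<And>x c T M m. x \<notin> F \<Longrightarrow> (\<And>i. i \<in> active x \<Longrightarrow> norm (patch i x - c) \<le> M) \<Longrightarrow>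
    (\<And>i. i \<in> active x \<Longrightarrow> norm (A (fst i) - T) \<le> m) \<Longrightarrow> norm (D x - T) \<le> m + C * M / infdist x F"
    by (rule D_estimate) blast
  \<comment> \<open>With d = \<open>infdist x F\<close>, the foot is within 3 d of the closest
    point, which costs \<open>3 * \<eta> * d\<close> by strictness, and the slope error on a vector
    of length 2 d costs \<open>2 * \<eta> * d\<close>. The derivative estimate then totals
    \<open>\<eta> + 5 * C * \<eta> = e\<close>.\<close>
  define \<eta> where "\<eta> = e / (1 + 5 * C)"
  have "\<eta> > 0" using C(1) \<open>e > 0\<close> by (simp add: \<eta>_def add_pos_nonneg)
  obtain \<delta>1 where \<delta>1: "\<delta>1 > 0" "\<And>x. x \<notin> F \<Longrightarrow> dist x a < \<delta>1 \<Longrightarrow> norm (A x - L a) < \<eta>"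
    using preserves_continuity[OF a cont \<open>\<eta> > 0\<close>] by blast
  obtain \<delta>2 where \<delta>2: "\<delta>2 > 0" "\<And>x y. x \<in> F \<Longrightarrow> y \<in> F \<Longrightarrow> dist x a < \<delta>2 \<Longrightarrow> dist y a < \<delta>2 \<Longrightarrow>
      norm (f y - f x - L a (y - x)) \<le> \<eta> * dist y x"
    using strict[unfolded rel_strict_iff, rule_format, OF \<open>\<eta> > 0\<close>] by blast
  have "norm (D x - L a) \<le> e" if x: "x \<notin> F" "dist x a < min (\<delta>1 / 2) (\<delta>2 / 3)" for x
  proof -
    define b where "b = closest_point F x"
    define d where "d = infdist x F"
    have b: "b \<in> F" "dist x b = d"
      using dist_closest_point by (auto simp: b_def d_def)
    have d: "d > 0" "d \<le> dist x a"
      using infdist_pos[OF x(1)] infdist_le[OF a] by (auto simp: d_def)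
    have "dist b a \<le> 2 * dist x a"
      using dist_triangle[of b a x] b d by (simp add: dist_commute)
    moreover have "3 * dist x a < \<delta>2"
      using x(2) by simp
    ultimately have ba: "dist b a < \<delta>2"
      using zero_le_dist[of x a] by linarith
    have "norm (D x - L a) \<le> \<eta> + C * (5 * \<eta> * d) / d"
      unfolding d_def
    proof (rule C(2)[OF x(1)], unfold d_def[symmetric])
      fix i assume i: "i \<in> active x"
      note p = active_dist[OF x(1) i, folded d_def] active_dist_point[OF x(1) i a, folded d_def]
      show Ai: "norm (A (fst i) - L a) \<le> \<eta>"
        using x(2) p by (intro less_imp_le[OF \<delta>1(2)]) auto
      have "dist (foot i) b \<le> 3 * d"
        using dist_triangle[of "foot i" b x] p(6) b by (simp add: dist_commute)
      have "norm (f (foot i) - f b - L a (foot i - b)) \<le> \<eta> * dist (foot i) b"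
        using x(2) p ba by (intro \<delta>2 b) auto
      also have "\<dots> \<le> \<eta> * (3 * d)"
        using \<open>dist (foot i) b \<le> 3 * d\<close> \<open>\<eta> > 0\<close> by (intro mult_left_mono) auto
      finally have 1: "norm (f (foot i) - f b - L a (foot i - b)) \<le> \<eta> * (3 * d)" .
      have "norm ((A (fst i) - L a) (x - foot i)) \<le> norm (A (fst i) - L a) * norm (x - foot i)"
        by (rule norm_blinfun)
      also have "\<dots> \<le> \<eta> * (2 * d)"
        using Ai p \<open>\<eta> > 0\<close> by (intro mult_mono) auto
      finally have 2: "norm ((A (fst i) - L a) (x - foot i)) \<le> \<eta> * (2 * d)" .
      have eq: "patch i x - (f b + L a (x - b))
          = (f (foot i) - f b - L a (foot i - b)) + (A (fst i) - L a) (x - foot i)"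
        by (simp add: patch_def blinfun.diff_right blinfun.diff_left)
      show "norm (patch i x - (f b + L a (x - b))) \<le> 5 * \<eta> * d"
        unfolding eq using norm_triangle_mono[OF 1 2] by simp
    qed
    also have "\<dots> = e"
      using d C(1) by (simp add: \<eta>_def field_simps add_nonneg_eq_0_iff)
    finally show ?thesis .
  qed
  then show ?thesis
    using \<delta>1(1) \<delta>2(1) by (intro exI[of _ "min (\<delta>1 / 2) (\<delta>2 / 3)"]) auto
qed

lemma ext_continuous_on:
  assumes "\<And>z. z \<in> U \<Longrightarrow> z \<in> F \<Longrightarrow> continuous (at z within F) f"
  shows "continuous_on U ext"
proof (rule continuous_at_imp_continuous_on, rule ballI)
  fix z assume "z \<in> U"
  then show "isCont ext z"
    using ext_continuous[of z] assms has_derivative_continuous[OF D_eq(1)[of z]] by blast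
qed

text \<open>Near \<open>a\<close>, \<open>ext - L a\<close> has derivative of norm at most
  \<open>e\<close> off \<open>F\<close> and is \<open>e\<close>-Lipschitz on \<open>F\<close>; the
  segment argument joins the two.\<close>

lemma ext_strict:
  assumes a: "a \<in> F" and cont: "continuous (at a within F) L" and strict: "rel_strict F f a (L a)"
  shows "rel_strict UNIV ext a (L a)"
  unfolding rel_strict_iff
proof (intro allI impI)
  fix e :: real assume "e > 0"
  obtain \<delta>1 where \<delta>1: "\<delta>1 > 0" "\<And>x. x \<notin> F \<Longrightarrow> dist x a < \<delta>1 \<Longrightarrow> norm (D x - L a) \<le> e"
    using D_near[OF assms \<open>e > 0\<close>] by blast
  obtain \<delta>2 where \<delta>2: "\<delta>2 > 0" "\<And>x y. x \<in> F \<Longrightarrow> y \<in> F \<Longrightarrow> dist x a < \<delta>2 \<Longrightarrow> dist y a < \<delta>2 \<Longrightarrow>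
      norm (f y - f x - L a (y - x)) \<le> e * dist y x"
    using strict[unfolded rel_strict_iff, rule_format, OF \<open>e > 0\<close>] by blast
  define \<delta> where "\<delta> = min \<delta>1 \<delta>2"
  let ?U = "ball a \<delta>"
  \<comment> \<open>Strictness at the single point \<open>a\<close> makes \<open>f\<close> Lipschitz
    on \<open>F\<close> in a whole ball, hence continuous at all nearby points of \<open>F\<close>,
    as needed along segments.\<close>
  have cont_f: "continuous (at z within F) f" if z: "z \<in> ?U" "z \<in> F" for z
  proof (rule lipschitz_bound_imp_continuous_within[OF open_ball z(1)])
    fix x assume x: "x \<in> ?U" "x \<in> F"
    have "norm (f x - f z - L a (x - z)) \<le> e * norm (x - z)"
      using \<delta>2(2)[OF z(2) x(2)] x(1) z(1) by (simp add: \<delta>_def dist_commute dist_norm)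
    then have "norm (f x - f z) \<le> e * norm (x - z) + norm (L a) * norm (x - z)"
      using norm_blinfun[of "L a" "x - z"] norm_triangle_sub[of "f x - f z" "L a (x - z)"] by linarith
    then show "norm (f x - f z) \<le> (e + norm (L a)) * norm (x - z)"
      by (simp add: distrib_right)
  qed
  have "norm (ext y - ext x - L a (y - x)) \<le> e * dist y x" if "x \<in> ?U" "y \<in> ?U" for x y
  proof -
    have "norm ((ext y - L a y) - (ext x - L a x)) \<le> e * norm (y - x)"
    proof (rule lipschitz_across_closed_set[where F = F and U = ?U and g' = "\<lambda>x. blinfun_apply (D x - L a)"])
      show "continuous_on ?U (\<lambda>x. ext x - L a x)"
        using cont_f by (intro continuous_intros ext_continuous_on) auto
      show "((\<lambda>x. ext x - L a x) has_derivative (D x - L a)) (at x)" if "x \<in> ?U - F" for x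
        using D_eq(1)[of x] that
        by (auto intro!: derivative_eq_intros simp: blinfun.diff_left)
      show "norm ((D x - L a) v) \<le> e * norm v" if "x \<in> ?U - F" for x v
      proof -
        have "norm (D x - L a) \<le> e"
          using that by (intro \<delta>1) (auto simp: \<delta>_def dist_commute)
        then show ?thesis
          using norm_blinfun[of "D x - L a" v] by (meson mult_right_mono norm_ge_zero order_trans)
      qed
      show "norm (ext y - L a y - (ext x - L a x)) \<le> e * norm (y - x)"
        if "x \<in> ?U \<inter> F" "y \<in> ?U \<inter> F" for x y
        using \<delta>2(2)[of x y] that
        by (simp add: ext_def \<delta>_def dist_norm norm_minus_commute blinfun.diff_right algebra_simps)
    qed (use closed that in auto)
    then show ?thesis
      by (simp add: dist_norm blinfun.diff_right algebra_simps)
  qed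
  then show "\<exists>\<delta>>0. \<forall>x\<in>UNIV. \<forall>y\<in>UNIV. dist x a < \<delta> \<longrightarrow> dist y a < \<delta> \<longrightarrow>
      norm (ext y - ext x - L a (y - x)) \<le> e * dist y x"
    using \<delta>1(1) \<delta>2(1) by (intro exI[of _ \<delta>]) (auto simp: \<delta>_def dist_commute)
qed

lemma ext_derivative_continuous:
  assumes a: "a \<in> F" and cont: "continuous (at a within F) L" and strict: "rel_strict F f a (L a)"
  shows "\<exists>D'. D' a = L a \<and> (\<forall>x\<in>- F \<union> {a}. (ext has_derivative blinfun_apply (D' x)) (at x)) \<and>
    continuous (at a within - F \<union> {a}) D'"
\<comment> \<open>Overwriting \<open>D\<close> at \<open>a\<close> avoids identifying the
  \<open>Blinfun\<close> value there.\<close>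
proof (rule exI[of _ "D(a := L a)"], intro conjI ballI)
  let ?D = "D(a := L a)"
  show "?D a = L a" by simp
  show "(ext has_derivative blinfun_apply (?D x)) (at x)" if "x \<in> - F \<union> {a}" for x
    using that D_eq(1)[of x] ext_has_derivative[OF a rel_strict_imp_rel_frechet[OF a strict]] by auto
  show "continuous (at a within - F \<union> {a}) ?D"
    unfolding continuous_within_eps_delta
  proof (intro allI impI)
    fix e :: real assume "e > 0"
    then obtain \<delta> where \<delta>: "\<delta> > 0" "\<And>x. x \<notin> F \<Longrightarrow> dist x a < \<delta> \<Longrightarrow> norm (D x - L a) \<le> e / 2"
      using D_near[OF assms half_gt_zero] by blast
    have "dist (?D x) (?D a) < e" if "x \<in> - F \<union> {a}" "dist x a < \<delta>" for x
      using \<delta>(2)[of x] that \<open>e > 0\<close> by (cases "x = a") (auto simp: dist_norm)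
    then show "\<exists>\<delta>>0. \<forall>x\<in>- F \<union> {a}. dist x a < \<delta> \<longrightarrow> dist (?D x) (?D a) < e"
      using \<delta>(1) by blast
  qed
qed

section \<open>Lipschitz continuity of the extension\<close>

text \<open>Comparison with the constant \<open>f (closest_point F x)\<close>: the foot is within 3
  d of the closest point and the slope acts on a vector of length at most 2 d, so a patch deviates
  by at most \<open>5 * k * d\<close>. Asking only about active indices makes the bound usable
  locally.\<close>

lemma D_bound:
  obtains C where "C \<ge> 0" "\<And>x k. x \<notin> F \<Longrightarrow> k \<ge> 0 \<Longrightarrow>
    (\<And>i. i \<in> active x \<Longrightarrow> norm (A (fst i)) \<le> k) \<Longrightarrow>
    (\<And>i. i \<in> active x \<Longrightarrow> norm (f (foot i) - f (closest_point F x)) \<le> k * dist (foot i) (closest_point F x)) \<Longrightarrow>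
    norm (D x) \<le> C * k"
proof -
  obtain C where C: "C \<ge> 0" "\<And>x c T M m. x \<notin> F \<Longrightarrow> (\<And>i. i \<in> active x \<Longrightarrow> norm (patch i x - c) \<le> M) \<Longrightarrow>
    (\<And>i. i \<in> active x \<Longrightarrow> norm (A (fst i) - T) \<le> m) \<Longrightarrow> norm (D x - T) \<le> m + C * M / infdist x F"
    by (rule D_estimate) blast
  have "norm (D x) \<le> (1 + 5 * C) * k" if x: "x \<notin> F" and k: "k \<ge> 0"
    and A: "\<And>i. i \<in> active x \<Longrightarrow> norm (A (fst i)) \<le> k"
    and lip: "\<And>i. i \<in> active x \<Longrightarrow> norm (f (foot i) - f (closest_point F x)) \<le> k * dist (foot i) (closest_point F x)"
    for x k
  proof -
    define b where "b = closest_point F x"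
    define d where "d = infdist x F"
    have b: "dist x b = d"
      using dist_closest_point by (auto simp: b_def d_def)
    have "norm (D x - 0) \<le> k + C * (5 * k * d) / d"
      unfolding d_def
    proof (rule C(2)[OF x], unfold d_def[symmetric])
      fix i assume i: "i \<in> active x"
      note p = active_dist[OF x i, folded d_def]
      show "norm (A (fst i) - 0) \<le> k"
        using A[OF i] by simp
      have "dist (foot i) b \<le> 3 * d"
        using dist_triangle[of "foot i" b x] p(6) b by (simp add: dist_commute)
      then have "k * dist (foot i) b \<le> k * (3 * d)"
        using k by (rule mult_left_mono)
      with lip[OF i] have 1: "norm (f (foot i) - f b) \<le> k * (3 * d)"
        by (simp add: b_def)
      have "norm (A (fst i) (x - foot i)) \<le> norm (A (fst i)) * norm (x - foot i)"
        by (rule norm_blinfun)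
      also have "\<dots> \<le> k * (2 * d)"
        using A[OF i] p(6) k by (intro mult_mono) (auto simp: dist_norm)
      finally have 2: "norm (A (fst i) (x - foot i)) \<le> k * (2 * d)" .
      have eq: "patch i x - f b = (f (foot i) - f b) + A (fst i) (x - foot i)"
        by (simp add: patch_def)
      show "norm (patch i x - f b) \<le> 5 * k * d"
        unfolding eq using norm_triangle_mono[OF 1 2] by (simp add: mult_ac)
    qed
    then show ?thesis
      using infdist_pos[OF x] by (simp add: d_def algebra_simps)
  qed
  with C(1) show ?thesis
    by (intro that[of "1 + 5 * C"]) auto
qed

text \<open>\<open>smooth_ext\<close> yields continuity of directional derivatives only; in finite
  dimension the values at basis vectors already bound the operator norm.\<close>

lemma D_bounded_on_compact:
  assumes "compact S" "S \<inter> F = {}"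
  obtains M where "\<And>x. x \<in> S \<Longrightarrow> norm (D x) \<le> M"
proof -
  have "\<exists>M. \<forall>x\<in>S. norm (D x b) \<le> M" for b
  proof -
    have "higher_differentiable_on (- F) ext (Suc 0)"
      by (rule smooth_ext)
    then have "continuous_on (- F) (\<lambda>x. frechet_derivative ext (at x) b)"
      by simp
    then have "continuous_on S (\<lambda>x. frechet_derivative ext (at x) b)"
      by (rule continuous_on_subset) (use assms in auto)
    then have "bounded ((\<lambda>x. frechet_derivative ext (at x) b) ` S)"
      using assms(1) compact_continuous_image compact_imp_bounded by blast
    then obtain M where "\<And>x. x \<in> S \<Longrightarrow> norm (frechet_derivative ext (at x) b) \<le> M"
      unfolding bounded_iff by blast
    moreover have "x \<notin> F" if "x \<in> S" for x
      using assms that by blast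
    ultimately show ?thesis
      by (auto simp: D_eq(2))
  qed
  then obtain M where M: "\<And>b x. x \<in> S \<Longrightarrow> norm (D x b) \<le> M b"
    by metis
  have "norm (D x) \<le> (\<Sum>b\<in>Basis. M b)" if "x \<in> S" for x
    using norm_blinfun_euclidean_le[of "D x"] sum_mono[of Basis "\<lambda>b. norm (D x b)" M, OF M[OF that]]
    by linarith
  then show ?thesis by (rule that)
qed

lemma ext_lipschitz_from_D_bound:
  assumes "open U" "convex U" "K \<ge> 0" "k-lipschitz_on (U \<inter> F) f"
    and "\<And>x. x \<in> U \<Longrightarrow> x \<notin> F \<Longrightarrow> norm (D x) \<le> K"
  shows "(max K k)-lipschitz_on U ext"
proof (rule lipschitz_onI)
  fix x y assume xy: "x \<in> U" "y \<in> U"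
  have lip: "norm (f x - f y) \<le> max K k * norm (x - y)" if "x \<in> U \<inter> F" "y \<in> U \<inter> F" for x y
  proof -
    have "dist (f x) (f y) \<le> k * dist x y"
      using assms(4) that by (rule lipschitz_onD)
    also have "\<dots> \<le> max K k * dist x y"
      by (intro mult_right_mono) auto
    finally show ?thesis by (simp add: dist_norm)
  qed
  have "norm (ext x - ext y) \<le> max K k * norm (x - y)"
  proof (rule lipschitz_across_closed_set[where F = F and U = U and g' = "\<lambda>x. blinfun_apply (D x)"])
    have "continuous (at z within F) f" if "z \<in> U" "z \<in> F" for z
      by (rule lipschitz_bound_imp_continuous_within[OF \<open>open U\<close> that(1)]) (use lip that in blast)
    then show "continuous_on U ext"
      by (rule ext_continuous_on)
    show "(ext has_derivative D x) (at x)" if "x \<in> U - F" for x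
      using D_eq(1) that by auto
    show "norm (D x v) \<le> max K k * norm v" if "x \<in> U - F" for x v
    proof -
      have "norm (D x) \<le> max K k"
        using assms(5)[of x] that by auto
      then show ?thesis
        using norm_blinfun[of "D x" v] by (meson mult_right_mono norm_ge_zero order_trans)
    qed
    show "norm (ext y - ext x) \<le> max K k * norm (y - x)" if "x \<in> U \<inter> F" "y \<in> U \<inter> F" for x y
      using lip[OF that(2,1)] that by (simp add: ext_def)
  qed (use assms(2) closed xy in auto)
  then show "dist (ext x) (ext y) \<le> max K k * dist x y"
    by (simp add: dist_norm)
qed (use assms(3) in simp)

lemma ext_lipschitz_global:
  assumes "bounded (L ` F)" "C-lipschitz_on F f"
  shows "\<exists>C. C-lipschitz_on UNIV ext"
proof -
  obtain B where B: "\<And>x. x \<in> F \<Longrightarrow> norm (L x) \<le> B"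
    using assms(1) by (auto simp: bounded_iff)
  define k where "k = max (max B C) 0"
  have "norm (A x) \<le> k" for x
    using field_values[of x] B by (fastforce simp: k_def)
  moreover have "norm (f x - f y) \<le> k * dist x y" if "x \<in> F" "y \<in> F" for x y
  proof -
    have "dist (f x) (f y) \<le> C * dist x y"
      using assms(2) that by (rule lipschitz_onD)
    also have "\<dots> \<le> k * dist x y"
      by (intro mult_right_mono) (auto simp: k_def)
    finally show ?thesis by (simp add: dist_norm)
  qed
  moreover obtain M where "M \<ge> 0" and M: "\<And>x k. x \<notin> F \<Longrightarrow> k \<ge> 0 \<Longrightarrow>
    (\<And>i. i \<in> active x \<Longrightarrow> norm (A (fst i)) \<le> k) \<Longrightarrow>
    (\<And>i. i \<in> active x \<Longrightarrow> norm (f (foot i) - f (closest_point F x)) \<le> k * dist (foot i) (closest_point F x)) \<Longrightarrow>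
    norm (D x) \<le> M * k"
    by (rule D_bound) blast
  ultimately have "norm (D x) \<le> M * k" if "x \<notin> F" for x
    using active_dist(2)[OF that] dist_closest_point(1) that by (intro M) (auto simp: k_def)
  then have "(max (M * k) C)-lipschitz_on UNIV ext"
    using assms(2) \<open>M \<ge> 0\<close> by (intro ext_lipschitz_from_D_bound) (auto simp: k_def)
  then show ?thesis by blast
qed

text \<open>Near \<open>F\<close> the slopes are 0 or values of \<open>L\<close> inside
  \<open>ball a R\<close>. Farther away they may come from outside that ball, but there the closed
  ball of radius \<open>r\<close> leaves a compact set disjoint from \<open>F\<close>.\<close>

lemma ext_lipschitz_local:
  assumes "a \<in> F" "bounded (L ` (ball a R \<inter> F))" "C-lipschitz_on (ball a R \<inter> F) f" "r < R"
  shows "\<exists>C. C-lipschitz_on (ball a r) ext"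
proof -
  obtain B where B: "\<And>x. x \<in> F \<Longrightarrow> dist x a < R \<Longrightarrow> norm (L x) \<le> B"
  proof -
    obtain B where "\<And>x. x \<in> ball a R \<inter> F \<Longrightarrow> norm (L x) \<le> B"
      using assms(2) unfolding bounded_iff by blast
    then show ?thesis
      by (intro that[of B]) (simp add: dist_commute)
  qed
  define k where "k = max (max B C) 0"
  \<comment> \<open>For \<open>infdist x F < s\<close> and \<open>dist x a < r\<close>, values of
    \<open>L\<close> are taken within \<open>r + s + s / 3\<close> of \<open>a\<close> and feet lie
    within \<open>r + 2 * s\<close>; both stay below \<open>R = r + 3 * s\<close>.\<close>
  define s where "s = (R - r) / 3"
  have "s > 0" using assms(4) by (simp add: s_def)
  obtain \<eta> where \<eta>: "\<eta> > 0" "\<And>x. x \<notin> F \<Longrightarrow> infdist x F < \<eta> \<Longrightarrow>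
      A x = 0 \<or> (\<exists>q\<in>F. dist q x < s \<and> A x = L q)"
    using local_values[OF \<open>s > 0\<close>] by blast
  \<comment> \<open>A centre can be twice as far from \<open>F\<close> as \<open>x\<close>, hence
    \<open>\<eta> / 2\<close>.\<close>
  define \<epsilon> where "\<epsilon> = min (\<eta> / 2) s"
  have "\<epsilon> > 0" using \<eta>(1) \<open>s > 0\<close> by (simp add: \<epsilon>_def)
  have lip: "norm (f x - f y) \<le> k * dist x y" if "x \<in> F" "y \<in> F" "dist x a < R" "dist y a < R" for x y
  proof -
    have "dist (f x) (f y) \<le> C * dist x y"
      using assms(3) by (rule lipschitz_onD) (use that in \<open>auto simp: dist_commute\<close>)
    also have "\<dots> \<le> k * dist x y"
      by (intro mult_right_mono) (auto simp: k_def)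
    finally show ?thesis by (simp add: dist_norm)
  qed
  obtain M where "M \<ge> 0" and M: "\<And>x k. x \<notin> F \<Longrightarrow> k \<ge> 0 \<Longrightarrow>
    (\<And>i. i \<in> active x \<Longrightarrow> norm (A (fst i)) \<le> k) \<Longrightarrow>
    (\<And>i. i \<in> active x \<Longrightarrow> norm (f (foot i) - f (closest_point F x)) \<le> k * dist (foot i) (closest_point F x)) \<Longrightarrow>
    norm (D x) \<le> M * k"
    by (rule D_bound) blast
  have near: "norm (D x) \<le> M * k" if x: "x \<notin> F" "dist x a < r" "infdist x F < \<epsilon>" for x
  proof (rule M[OF x(1)])
    show "k \<ge> 0" by (simp add: k_def)
    fix i assume i: "i \<in> active x"
    note p = active_dist[OF x(1) i]
    have "infdist (fst i) F < \<eta>"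
      using p(5) x(3) by (simp add: \<epsilon>_def)
    with \<eta>(2)[OF p(1)] consider "A (fst i) = 0"
      | q where "q \<in> F" "dist q (fst i) < s" "A (fst i) = L q"
      by blast
    then show "norm (A (fst i)) \<le> k"
    proof cases
      case 2
      have "dist q a \<le> dist q (fst i) + dist (fst i) x + dist x a"
        using dist_triangle[of q a "fst i"] dist_triangle[of "fst i" a x] by simp
      then have "dist q a < R"
        using 2(2) p(3) x(2,3) infdist_nonneg[of x F] \<open>s > 0\<close>
        by (simp add: dist_commute \<epsilon>_def s_def)
      then show ?thesis
        using B[OF 2(1)] 2(3) by (simp add: k_def)
    qed (simp add: k_def)
    have "dist (foot i) a < R" "dist (closest_point F x) a < R"
      using p(6) x(2,3) dist_triangle[of "foot i" a x] dist_triangle[of "closest_point F x" a x]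
        dist_closest_point(2)[of x] \<open>s > 0\<close>
      by (auto simp: dist_commute \<epsilon>_def s_def)
    then show "norm (f (foot i) - f (closest_point F x)) \<le> k * dist (foot i) (closest_point F x)"
      by (intro lip p(2) dist_closest_point(1))
  qed
  let ?S = "cball a r \<inter> (\<lambda>x. infdist x F) -` {\<epsilon>..}"
  have "closed ((\<lambda>x. infdist x F) -` {\<epsilon>..})"
    by (intro closed_vimage continuous_intros)
  then have "compact ?S"
    by (intro compact_Int_closed) auto
  moreover have "?S \<inter> F = {}"
    using \<open>\<epsilon> > 0\<close> by auto
  ultimately obtain M' where M': "\<And>x. x \<in> ?S \<Longrightarrow> norm (D x) \<le> M'"
    by (rule D_bounded_on_compact) blast
  have "C-lipschitz_on (ball a r \<inter> F) f"
    using assms(3) by (rule lipschitz_on_subset) (use assms(4) in auto)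
  moreover have "norm (D x) \<le> max (M * k) M'" if "x \<in> ball a r" "x \<notin> F" for x
    using near[OF that(2)] M'[of x] that(1)
    by (cases "infdist x F < \<epsilon>") (auto simp: dist_commute)
  ultimately have "(max (max (M * k) M') C)-lipschitz_on (ball a r) ext"
    using \<open>M \<ge> 0\<close> by (intro ext_lipschitz_from_D_bound) (auto simp: k_def le_max_iff_disj)
  then show ?thesis by blast
qed

end

theorem theorem4p1:
  fixes F :: "'a::euclidean_space set"
    and f :: "'a \<Rightarrow> 'b::real_normed_vector"
    and L :: "'a \<Rightarrow> ('a \<Rightarrow>\<^sub>L 'b)"
  assumes "closed F"
    and "baire_one_on F L"
  shows "\<exists>fbar :: 'a \<Rightarrow> 'b.
    (\<forall>x\<in>F. fbar x = f x) \<and>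
    (\<forall>a\<in>F. continuous (at a within F) f \<longrightarrow> continuous (at a) fbar) \<and>
    (\<forall>a\<in>F. \<forall>\<alpha>. 0 < \<alpha> \<and> \<alpha> \<le> 1 \<and> holder_at F f a \<alpha> \<longrightarrow> holder_at UNIV fbar a \<alpha>) \<and>
    (\<forall>a\<in>F. lipschitz_at F f a \<longrightarrow> lipschitz_at UNIV fbar a) \<and>
    (\<forall>a\<in>F. rel_frechet F f a (L a) \<longrightarrow> (fbar has_derivative blinfun_apply (L a)) (at a)) \<and>
    smooth_on (- F) fbar \<and>
    (\<forall>a\<in>F. continuous (at a within F) L \<and> rel_strict F f a (L a) \<longrightarrow>
        (\<exists>D :: 'a \<Rightarrow> ('a \<Rightarrow>\<^sub>L 'b).
           D a = L a \<and>
           (\<forall>x\<in>(- F) \<union> {a}. (fbar has_derivative blinfun_apply (D x)) (at x)) \<and>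
           continuous (at a within ((- F) \<union> {a})) D) \<and>
        rel_strict UNIV fbar a (L a)) \<and>
    (\<forall>a\<in>F. \<forall>R>0. bounded (L ` (ball a R \<inter> F)) \<and> (\<exists>C. C-lipschitz_on (ball a R \<inter> F) f) \<longrightarrow>
        (\<forall>r<R. \<exists>C. C-lipschitz_on (ball a r) fbar)) \<and>
    (bounded (L ` F) \<and> (\<exists>C. C-lipschitz_on F f) \<longrightarrow> (\<exists>C. C-lipschitz_on UNIV fbar))"
proof (cases "F = {}")
  \<comment> \<open>Closest points exist only for nonempty \<open>F\<close>; otherwise any smooth
    Lipschitz map, such as 0, will do.\<close>
  case True
  have "0-lipschitz_on UNIV (\<lambda>x::'a. 0::'b)"
    by (rule lipschitz_onI) auto
  then show ?thesis
    using True by (intro exI[of _ "\<lambda>x. 0"]) (auto simp: smooth_on_def)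
next
  case False
  obtain A where A:
    "\<And>a e. a \<in> F \<Longrightarrow> e > 0 \<Longrightarrow>
      \<exists>\<delta>>0. \<forall>x. x \<notin> F \<and> dist x a < \<delta> \<longrightarrow> norm (A x - L a) * infdist x F \<le> e * dist x a"
    "\<And>a e. a \<in> F \<Longrightarrow> continuous (at a within F) L \<Longrightarrow> e > 0 \<Longrightarrow>
      \<exists>\<delta>>0. \<forall>x. x \<notin> F \<and> dist x a < \<delta> \<longrightarrow> norm (A x - L a) < e"
    "\<And>e. e > 0 \<Longrightarrow> \<exists>\<delta>>0. \<forall>x. x \<notin> F \<and> infdist x F < \<delta> \<longrightarrow>
      A x = 0 \<or> (\<exists>q\<in>F. dist q x < e \<and> A x = L q)"
    "\<And>x. A x = 0 \<or> A x \<in> L ` F"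
    by (rule baire_one_field_off_closed[OF \<open>closed F\<close> False \<open>baire_one_on F L\<close>]) blast
  interpret whitney_baire_one F f A L
    by unfold_locales (use \<open>closed F\<close> False A in auto)
  show ?thesis
  proof (intro exI[of _ ext] conjI ballI allI impI)
    show "ext x = f x" if "x \<in> F" for x
      using that by (simp add: ext_def)
    show "smooth_on (- F) ext"
      by (simp add: smooth_on_def smooth_ext)
    show "\<exists>C. C-lipschitz_on UNIV ext" if "bounded (L ` F) \<and> (\<exists>C. C-lipschitz_on F f)"
      using that ext_lipschitz_global by blast
    fix a assume a: "a \<in> F"
    show "continuous (at a) ext" if "continuous (at a within F) f"
      using ext_continuous[OF a that] .
    show "holder_at UNIV ext a \<alpha>" if "0 < \<alpha> \<and> \<alpha> \<le> 1 \<and> holder_at F f a \<alpha>" for \<alpha>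
      using ext_holder[OF a] that by blast
    show "lipschitz_at UNIV ext a" if "lipschitz_at F f a"
      using ext_holder[OF a, of 1] that by (simp add: lipschitz_at_def)
    show "(ext has_derivative L a) (at a)" if "rel_frechet F f a (L a)"
      by (rule ext_has_derivative[OF a that])
    show "\<exists>D'. D' a = L a \<and> (\<forall>x\<in>- F \<union> {a}. (ext has_derivative blinfun_apply (D' x)) (at x)) \<and>
        continuous (at a within - F \<union> {a}) D'" "rel_strict UNIV ext a (L a)"
      if "continuous (at a within F) L \<and> rel_strict F f a (L a)"
      using that ext_derivative_continuous[OF a] ext_strict[OF a] by blast+
    show "\<exists>C. C-lipschitz_on (ball a r) ext"
      if "bounded (L ` (ball a R \<inter> F)) \<and> (\<exists>C. C-lipschitz_on (ball a R \<inter> F) f)" "r < R" for R r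
      using that ext_lipschitz_local[OF a] by blast
  qed
qed

end
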